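(* Let $(S,\mathcal S)$ be a metric space with its Borel $\sigma$-field and let $X=(X_n,n\in\mathbb T)$ be a bifurcating Markov chain on $S$ with initial distribution $\nu$ and $\mathbb T$-transition probability $P$. Let $F$ be an admissible space of functions with limit probability $\mu$. Let $f:S^3\to\mathbb R$ be measurable and such that $Pf$, $Pf^2$ and $Pf^4$ exist and belong to $F$. Then $|\mathbb T_r|^{1/2}\big(\overline M_{\mathbb T_r}(f)-\overline M_{\mathbb T_r}(Pf)\big)$ converges in distribution, as $r\to\infty$, to $\mathcal N(0,s^2)$, where $s^2=(\mu,Pf^2)-(\mu,(Pf)^2)$.
   Context: Tree. $\mathbb T=\mathbb N^*=\{1,2,\dots\}$ is the binary tree: vertex $n$ has two daughters $2n$ and $2n+1$, the root is $1$. $\mathbb G_q=\{2^q,\dots,2^{q+1}-1\}$ is the $q$th generation, $\mathbb T_r=\bigcup_{q=0}^r\mathbb G_q$ (so $|\mathbb T_r|=2^{r+1}-1$), $r_n=\lfloor\log_2 n\rfloor$ is the generation of $n$. $\mathbb T$-transition probability. A map $P:S\times\mathcal S^2\to[0,1]$ ($\mathcal S^2$ the product $\sigma$-field on $S^2$) such that $P(\cdot,A)$ is measurable for all $A\in\mathcal S^2$ and $P(x,\cdot)$ is a probability on $(S^2,\mathcal S^2)$ for all $x\in S$. Put $P_0(x,B)=P(x,B\times S)$, $P_1(x,B)=P(x,S\times B)$, $Q=(P_0+P_1)/2$; $Q^r$ is the $r$th iterate of $Q$ and $Q^rf(x)=\int_S f(y)Q^r(x,dy)$. When defined, $Pf(x)=\int_{S^2}f(y,z)P(x,dy\,dz)$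 for measurable $f:S^2\to\mathbb R$, and $Pf(x)=\int_{S^2}f(x,y,z)P(x,dy\,dz)$ for measurable $f:S^3\to\mathbb R$. $Pf^k$ means $P(f^k)$. Bifurcating Markov chain. On a filtered probability space $(\Omega,\mathcal F,(\mathcal F_r)_{r\in\mathbb N},\mathbb P)$, a family $(X_n,n\in\mathbb T)$ of $S$-valued random variables is a bifurcating Markov chain with initial distribution $\nu$ and $\mathbb T$-transition probability $P$ if $X_n$ is $\mathcal F_{r_n}$-measurable for all $n$, $X_1$ has law $\nu$, and for all $q\in\mathbb N$ and all families $(f_n,n\in\mathbb G_q)$ of bounded measurable functions on $S^2$, $\mathbb E[\prod_{n\in\mathbb G_q}f_n(X_{2n},X_{2n+1})\mid\mathcal F_q]=\prod_{n\in\mathbb G_q}Pf_n(X_n)$. The default filtration is $\mathcal F_r=\sigma(X_i,i\in\mathbb T_r)$. Admissible space. Let $\mathcal B(S)$ be the set of measurable functions $S\to\mathbb R$, and $(f\otimes g)(y,z)=f(y)g(z)$. A linear subspace $F\subset\mathcal B(S)$ is called admissible with limit probability $\mu$ (relative to $P,\nu$) if: (i) $F$ contains the constants; (ii) $f^2\in F$ for all $f\in F$; (iii) for all $f,g\in F$, $f\otimes g\in L^1(P(x,\cdot))$ for all $x\in S$, and $P(f\otimes g)\in F$; (iv) $\mu$ is a probability on $(S,\mathcal S)$ with $F\subset L^1(\mu)$ and $\lim_{r\to\infty}Q^rf(x)=\int_S f\,d\mu$ for all $x\in S$ and $f\in F$; (v) for all $f\in F$ there is $g\in F$ such that $|Q^rf|\le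 g$ for all $r\in\mathbb N$; (vi) $F\subset L^1(\nu)$. (Conditions (i) and (iii) imply that $Q^rf$ is well defined for $f\in F$.) Averages. $\Delta_i=(X_i,X_{2i},X_{2i+1})$. $\overline M_{\mathbb T_r}(f)=|\mathbb T_r|^{-1}\sum_{i\in\mathbb T_r}f(\Delta_i)$ for measurable $f:S^3\to\mathbb R$, and $\overline M_{\mathbb T_r}(g)=|\mathbb T_r|^{-1}\sum_{i\in\mathbb T_r}g(X_i)$ for measurable $g:S\to\mathbb R$. $(\mu,g)=\int_S g\,d\mu$. *)

theory Defs
  imports "HOL-Probability.Probability"
begin

text \<open>The vertices of the binary tree are the positive natural numbers; vertex \<open>n\<close> has the
  daughters \<open>2 * n\<close> and \<open>2 * n + 1\<close>. Values at the index \<open>0\<close> are never used.\<close>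

definition generation :: "nat \<Rightarrow> nat set" where
  "generation q = {2 ^ q..<2 ^ Suc q}"

definition tree_upto :: "nat \<Rightarrow> nat set" where
  "tree_upto r = (\<Union>q\<le>r. generation q)"

definition gen_of :: "nat \<Rightarrow> nat" where
  "gen_of n = nat \<lfloor>log 2 (real n)\<rfloor>"

text \<open>On a metric space that is not separable, the product \<open>\<sigma>\<close>-field
  \<open>borel \<Otimes>\<^sub>M borel\<close> may be smaller than the Borel \<open>\<sigma>\<close>-field of the product space; all kernels
  and functions on products below refer to the product \<open>\<sigma>\<close>-field.\<close>

definition T_transition :: "('a::metric_space \<Rightarrow> ('a \<times> 'a) measure) \<Rightarrow> bool" where
  "T_transition P \<longleftrightarrow>
     (\<forall>x. prob_space (P x) \<and> sets (P x) = sets (borel \<Otimes>\<^sub>M borel)) \<and>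
     (\<forall>A \<in> sets (borel \<Otimes>\<^sub>M borel). (\<lambda>x. measure (P x) A) \<in> borel_measurable borel)"

text \<open>The operator \<open>P\<close> on functions on \<open>S\<^sup>2\<close> and on functions on \<open>S\<^sup>3\<close>. The Bochner integral is \<open>0\<close>
  for functions that are not integrable, so existence has to be demanded separately.\<close>

definition P2 :: "('a \<Rightarrow> ('a \<times> 'a) measure) \<Rightarrow> ('a \<times> 'a \<Rightarrow> real) \<Rightarrow> 'a \<Rightarrow> real" where
  "P2 P f x = (\<integral>p. f p \<partial>P x)"

definition P3 :: "('a \<Rightarrow> ('a \<times> 'a) measure) \<Rightarrow> ('a \<times> 'a \<times> 'a \<Rightarrow> real) \<Rightarrow> 'a \<Rightarrow> real" where
  "P3 P f x = (\<integral>p. f (x, p) \<partial>P x)"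

definition P3_exists :: "('a \<Rightarrow> ('a \<times> 'a) measure) \<Rightarrow> ('a \<times> 'a \<times> 'a \<Rightarrow> real) \<Rightarrow> bool" where
  "P3_exists P f \<longleftrightarrow> (\<forall>x. integrable (P x) (\<lambda>p. f (x, p)))"

definition tensor :: "('a \<Rightarrow> real) \<Rightarrow> ('a \<Rightarrow> real) \<Rightarrow> 'a \<times> 'a \<Rightarrow> real" where
  "tensor f g = (\<lambda>(y, z). f y * g z)"

definition P_left :: "('a::metric_space \<Rightarrow> ('a \<times> 'a) measure) \<Rightarrow> 'a \<Rightarrow> 'a measure" where
  "P_left P x = distr (P x) borel fst"

definition P_right :: "('a::metric_space \<Rightarrow> ('a \<times> 'a) measure) \<Rightarrow> 'a \<Rightarrow> 'a measure" where
  "P_right P x = distr (P x) borel snd"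

definition Q_kernel :: "('a::metric_space \<Rightarrow> ('a \<times> 'a) measure) \<Rightarrow> 'a \<Rightarrow> 'a measure" where
  "Q_kernel P x =
     measure_of UNIV (sets borel) (\<lambda>B. (emeasure (P_left P x) B + emeasure (P_right P x) B) / 2)"

lemma sets_Q_kernel: "sets (Q_kernel P x) = sets borel"
  unfolding Q_kernel_def by (metis sets.sets_measure_of_eq space_borel)

lemma emeasure_Q_kernel:
  assumes "B \<in> sets borel"
  shows "emeasure (Q_kernel P x) B = (emeasure (P_left P x) B + emeasure (P_right P x) B) / 2"
proof (rule emeasure_measure_of[OF Q_kernel_def])
  show "countably_additive (sets (Q_kernel P x))
          (\<lambda>B. (emeasure (P_left P x) B + emeasure (P_right P x) B) / 2)"
  proof (rule countably_additiveI)
    fix A :: "nat \<Rightarrow> 'a set"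
    assume A: "range A \<subseteq> sets (Q_kernel P x)" "disjoint_family A"
    have [simp]: "(\<Sum>i. emeasure (P_left P x) (A i)) = emeasure (P_left P x) (\<Union>i. A i)"
      by (rule suminf_emeasure) (use A in \<open>auto simp: P_left_def sets_Q_kernel\<close>)
    have [simp]: "(\<Sum>i. emeasure (P_right P x) (A i)) = emeasure (P_right P x) (\<Union>i. A i)"
      by (rule suminf_emeasure) (use A in \<open>auto simp: P_right_def sets_Q_kernel\<close>)
    show "(\<Sum>i. (emeasure (P_left P x) (A i) + emeasure (P_right P x) (A i)) / 2) =
            (emeasure (P_left P x) (\<Union>i. A i) + emeasure (P_right P x) (\<Union>i. A i)) / 2"
      by (simp add: divide_ennreal_def suminf_add[symmetric])
  qed
qed (use assms in \<open>auto simp: sets_Q_kernel positive_def\<close>)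

primrec Q_iter :: "('a::metric_space \<Rightarrow> ('a \<times> 'a) measure) \<Rightarrow> nat \<Rightarrow> 'a \<Rightarrow> 'a measure" where
  "Q_iter P 0 x = return borel x"
| "Q_iter P (Suc r) x = Giry_Monad.bind (Q_iter P r x) (Q_kernel P)"

definition Q_op :: "('a::metric_space \<Rightarrow> ('a \<times> 'a) measure) \<Rightarrow> nat \<Rightarrow> ('a \<Rightarrow> real) \<Rightarrow> 'a \<Rightarrow> real" where
  "Q_op P r f x = (\<integral>y. f y \<partial>Q_iter P r x)"

definition bifurcating_markov_chain ::
  "'b measure \<Rightarrow> (nat \<Rightarrow> 'b measure) \<Rightarrow> (nat \<Rightarrow> 'b \<Rightarrow> 'a::metric_space) \<Rightarrow>
     'a measure \<Rightarrow> ('a \<Rightarrow> ('a \<times> 'a) measure) \<Rightarrow> bool" where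
  "bifurcating_markov_chain M Fl X \<nu> P \<longleftrightarrow>
     prob_space M \<and> filtration (space M) Fl \<and> (\<forall>r. subalgebra M (Fl r)) \<and>
     T_transition P \<and>
     (\<forall>n\<ge>1. X n \<in> measurable (Fl (gen_of n)) borel) \<and>
     distr M borel (X 1) = \<nu> \<and>
     (\<forall>q f. (\<forall>n\<in>generation q. f n \<in> borel_measurable (borel \<Otimes>\<^sub>M borel) \<and> bounded (range (f n))) \<longrightarrow>
        (AE \<omega> in M. real_cond_exp M (Fl q)
             (\<lambda>\<omega>. \<Prod>n\<in>generation q. f n (X (2 * n) \<omega>, X (2 * n + 1) \<omega>)) \<omega> =
           (\<Prod>n\<in>generation q. P2 P (f n) (X n \<omega>))))"

text \<open>Closure under addition and scalar multiplication is spelled out because the function type is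
  not an instance of class \<open>real_vector\<close>.\<close>

definition admissible_space ::
  "('a::metric_space \<Rightarrow> ('a \<times> 'a) measure) \<Rightarrow> 'a measure \<Rightarrow> 'a measure \<Rightarrow> ('a \<Rightarrow> real) set \<Rightarrow> bool" where
  "admissible_space P \<nu> \<mu> F \<longleftrightarrow>
     F \<subseteq> borel_measurable borel \<and>
     (\<forall>f\<in>F. \<forall>g\<in>F. (\<lambda>x. f x + g x) \<in> F) \<and>
     (\<forall>c. \<forall>f\<in>F. (\<lambda>x. c * f x) \<in> F) \<and>
     (\<forall>c. (\<lambda>x. c) \<in> F) \<and>
     (\<forall>f\<in>F. (\<lambda>x. (f x)\<^sup>2) \<in> F) \<and>
     (\<forall>f\<in>F. \<forall>g\<in>F. (\<forall>x. integrable (P x) (tensor f g)) \<and> P2 P (tensor f g) \<in> F) \<and>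
     prob_space \<mu> \<and> sets \<mu> = sets borel \<and>
     (\<forall>f\<in>F. integrable \<mu> f) \<and>
     (\<forall>f\<in>F. \<forall>x. (\<lambda>r. Q_op P r f x) \<longlonglongrightarrow> (\<integral>y. f y \<partial>\<mu>)) \<and>
     (\<forall>f\<in>F. \<exists>g\<in>F. \<forall>r x. \<bar>Q_op P r f x\<bar> \<le> g x) \<and>
     (\<forall>f\<in>F. integrable \<nu> f)"

definition tree_avg :: "(nat \<Rightarrow> 'b \<Rightarrow> 'a) \<Rightarrow> nat \<Rightarrow> ('a \<Rightarrow> real) \<Rightarrow> 'b \<Rightarrow> real" where
  "tree_avg X r g \<omega> = (\<Sum>i\<in>tree_upto r. g (X i \<omega>)) / real (card (tree_upto r))"

definition tree_avg_triangle ::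
  "(nat \<Rightarrow> 'b \<Rightarrow> 'a) \<Rightarrow> nat \<Rightarrow> ('a \<times> 'a \<times> 'a \<Rightarrow> real) \<Rightarrow> 'b \<Rightarrow> real" where
  "tree_avg_triangle X r f \<omega> =
     (\<Sum>i\<in>tree_upto r. f (X i \<omega>, X (2 * i) \<omega>, X (2 * i + 1) \<omega>)) / real (card (tree_upto r))"

text \<open>The normal law with mean \<open>m\<close> and variance \<open>v\<close>. For \<open>v = 0\<close> it is the Dirac measure at \<open>m\<close>,
  where \<open>normal_density m 0\<close> would be the zero function.\<close>

definition normal_law :: "real \<Rightarrow> real \<Rightarrow> real measure" where
  "normal_law m v =
     (if v = 0 then return borel m else density lborel (\<lambda>x. ennreal (normal_density m (sqrt v) x)))"

end

theory Submission
  imports Defs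
begin

text \<open>
  Put \<open>g(x, y, z) = f(x, y, z) - Pf(x)\<close> and let \<open>D\<^sub>q\<close> be the sum of \<open>g(\<Delta>\<^sub>i)\<close> over the \<open>q\<close>th generation.
  Because a generation has a non-negligible share of the whole tree, no general martingale limit
  theorem is needed. Conditionally on \<open>F\<^sub>q\<close> the summands of \<open>D\<^sub>q\<close> are independent and centred, with
  variances \<open>v(X\<^sub>i)\<close>, \<open>v = Pf\<^sup>2 - (Pf)\<^sup>2\<close>, so a second order expansion (with the fourth moments
  controlling the remainder) and the law of large numbers for the averages of \<open>v\<close> over the \<open>q\<close>th
  generation show that the conditional characteristic function of \<open>D\<^sub>q\<close> at \<open>\<theta>\<close> is
  \<open>exp(-\<theta>\<^sup>2 2\<^sup>q s\<^sup>2 / 2)\<close> up to an \<open>L\<^sup>1\<close> error \<open>\<theta>\<^sup>2 2\<^sup>q o(1) + O(2\<^sup>q |\<theta>|\<^sup>3)\<close>. At \<open>\<theta> = t / |T\<^sub>r|\<^sup>1\<^sup>/\<^sup>2\<close> these errors,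
  summed over the generations, tend to zero, and Levy's theorem applies.

  The law of large numbers comes from a recursion for second moments: passing from generation
  \<open>q\<close> to \<open>q + 1\<close> replaces \<open>u\<close> by \<open>Qu\<close> up to an error \<open>O(2\<^sup>-\<^sup>q)\<close>, while \<open>Q\<^sup>m u\<close> tends to \<open>(\<mu>, u)\<close>
  boundedly in \<open>F\<close>.
\<close>

section \<open>Integrals over composed kernels, the normal law, uniqueness of measures on
  products\<close>

text \<open>The nonnegative integral formula is applied to the positive and the negative part of
  \<open>f\<close>. Integrability makes both inner integrals finite almost everywhere, and there
  their difference is the inner Bochner integral; where it takes its default value 0 instead, only a
  null set is concerned.\<close>

lemma integral_bind_integrable:
  fixes f :: "'b \<Rightarrow> real"
  assumes K [measurable]: "K \<in> N \<rightarrow>\<^sub>M subprob_algebra L" and ne: "space N \<noteq> {}"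
    and f: "integrable (Giry_Monad.bind N K) f"
  shows "integrable N (\<lambda>x. \<integral>y. f y \<partial>K x)"
    and "(\<integral>y. f y \<partial>Giry_Monad.bind N K) = (\<integral>x. (\<integral>y. f y \<partial>K x) \<partial>N)"
proof -
  have "sets (Giry_Monad.bind N K) = sets L"
    using ne by (intro sets_bind) (auto dest: sets_kernel[OF K])
  then have [measurable]: "f \<in> borel_measurable L"
    using borel_measurable_integrable[OF f] by (simp cong: measurable_cong_sets)
  define p m where "p x = (\<integral>\<^sup>+y. ennreal (f y) \<partial>K x)" and "m x = (\<integral>\<^sup>+y. ennreal (- f y) \<partial>K x)" for x
  have [measurable]: "p \<in> borel_measurable N" "m \<in> borel_measurable N"
    unfolding p_def m_def
    by (rule measurable_compose[OF K nn_integral_measurable_subprob_algebra]; measurable)+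
  have P: "(\<integral>\<^sup>+y. ennreal (f y) \<partial>Giry_Monad.bind N K) = (\<integral>\<^sup>+x. p x \<partial>N)"
    unfolding p_def by (rule nn_integral_bind[OF _ K]) measurable
  have M: "(\<integral>\<^sup>+y. ennreal (- f y) \<partial>Giry_Monad.bind N K) = (\<integral>\<^sup>+x. m x \<partial>N)"
    unfolding m_def by (rule nn_integral_bind[OF _ K]) measurable
  have fin: "(\<integral>\<^sup>+x. p x \<partial>N) \<noteq> \<infinity>" "(\<integral>\<^sup>+x. m x \<partial>N) \<noteq> \<infinity>"
    using f by (simp_all add: real_integrable_def P M)
  have AEp: "AE x in N. p x \<noteq> \<infinity>" and AEm: "AE x in N. m x \<noteq> \<infinity>"
    by (intro nn_integral_PInf_AE; use fin in simp)+
  have pe: "(\<integral>\<^sup>+x. ennreal (enn2real (p x)) \<partial>N) = (\<integral>\<^sup>+x. p x \<partial>N)"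
    by (rule nn_integral_cong_AE) (use AEp in \<open>auto simp: top.not_eq_extremum\<close>)
  have me: "(\<integral>\<^sup>+x. ennreal (enn2real (m x)) \<partial>N) = (\<integral>\<^sup>+x. m x \<partial>N)"
    by (rule nn_integral_cong_AE) (use AEm in \<open>auto simp: top.not_eq_extremum\<close>)
  have ip: "integrable N (\<lambda>x. enn2real (p x))" and im: "integrable N (\<lambda>x. enn2real (m x))"
    using fin by (auto intro!: integrableI_nonneg simp: pe me top.not_eq_extremum)
  have eq: "AE x in N. (\<integral>y. f y \<partial>K x) = enn2real (p x) - enn2real (m x)"
    using AEp AEm AE_space
  proof eventually_elim
    case (elim x)
    then have "f \<in> borel_measurable (K x)"
      by (simp cong: measurable_cong_sets add: sets_kernel[OF K])
    with elim have "integrable (K x) f" by (simp add: real_integrable_def p_def m_def)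
    then show ?case by (simp add: real_lebesgue_integral_def p_def m_def)
  qed
  have [measurable]: "(\<lambda>x. \<integral>y. f y \<partial>K x) \<in> borel_measurable N"
    by (rule measurable_compose[OF K integral_measurable_subprob_algebra]) measurable
  show "integrable N (\<lambda>x. \<integral>y. f y \<partial>K x)"
    using eq ip im by (subst integrable_cong_AE[OF _ _ eq]) auto
  have "(\<integral>x. (\<integral>y. f y \<partial>K x) \<partial>N) = (\<integral>x. enn2real (p x) - enn2real (m x) \<partial>N)"
    by (rule integral_cong_AE) (use eq in auto)
  also have "\<dots> = enn2real (\<integral>\<^sup>+x. p x \<partial>N) - enn2real (\<integral>\<^sup>+x. m x \<partial>N)"
    using ip im by (simp add: integral_eq_nn_integral pe me)
  also have "\<dots> = (\<integral>y. f y \<partial>Giry_Monad.bind N K)"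
    using f by (simp add: real_lebesgue_integral_def P M)
  finally show "(\<integral>y. f y \<partial>Giry_Monad.bind N K) = (\<integral>x. (\<integral>y. f y \<partial>K x) \<partial>N)" ..
qed

lemma real_distribution_normal_law:
  assumes "0 \<le> v" shows "real_distribution (normal_law m v)"
proof (cases "v = 0")
  case True
  then show ?thesis
    by (auto simp: normal_law_def real_distribution_def real_distribution_axioms_def intro!: prob_space_return)
next
  case False
  with assms have "0 < sqrt v" by simp
  then show ?thesis using False prob_space_normal_density
    by (auto simp: normal_law_def real_distribution_def real_distribution_axioms_def)
qed

text \<open>The law is the image of the standard normal law under multiplication by
  \<open>sqrt v\<close>, so its characteristic function at \<open>t\<close> is the standard one at
  \<open>t * sqrt v\<close>. The Dirac case \<open>v = 0\<close> gives 1, in agreement with the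
  formula.\<close>

lemma char_normal_law:
  assumes "0 \<le> v" shows "char (normal_law 0 v) t = complex_of_real (exp (- (t\<^sup>2 * v) / 2))"
proof (cases "v = 0")
  case True
  then show ?thesis by (simp add: normal_law_def char_def integral_return)
next
  case False
  with assms have pos: "0 < sqrt v" by simp
  interpret S: real_distribution std_normal_distribution by (rule real_dist_normal_dist)
  have D: "distributed std_normal_distribution lborel (\<lambda>x. x) (normal_density 0 1)"
    unfolding distributed_def by (simp add: distr_id2 normal_density_nonneg)
  have "distributed std_normal_distribution lborel (\<lambda>x. 0 + sqrt v * x) (normal_density (0 + sqrt v * 0) (\<bar>sqrt v\<bar> * 1))"
    by (rule S.normal_density_affine[OF D]) (use pos in auto)
  then have "distr std_normal_distribution lborel (\<lambda>x. sqrt v * x) = normal_law 0 v"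
    using False pos by (simp add: distributed_def normal_law_def)
  then have E: "normal_law 0 v = distr std_normal_distribution borel (\<lambda>x. sqrt v * x)"
    by (metis (no_types, lifting) distr_cong sets_lborel)
  have "char (normal_law 0 v) t = char std_normal_distribution (t * sqrt v)"
    unfolding E char_def by (subst integral_distr) (auto simp: mult_ac)
  then show ?thesis using assms by (simp add: char_std_normal_distribution power_mult_distrib)
qed

text \<open>The rectangles are stable under intersection and generate the product sigma-field; for
  finite \<open>I\<close> the whole space is one of them. This is the uniqueness argument behind
  \<open>joint_law\<close>.\<close>

lemma measure_eqI_pair_PiM:
  fixes m1 m2 :: "('b \<times> ('i \<Rightarrow> 'c)) measure"
  assumes I: "finite I"
    and s1: "sets m1 = sets (R \<Otimes>\<^sub>M PiM I N)" and s2: "sets m2 = sets (R \<Otimes>\<^sub>M PiM I N)"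
    and fin: "emeasure m1 (space m1) \<noteq> \<infinity>"
    and eq: "\<And>A B. A \<in> sets R \<Longrightarrow> (\<And>i. i \<in> I \<Longrightarrow> B i \<in> sets (N i)) \<Longrightarrow>
      emeasure m1 (A \<times> Pi\<^sub>E I B) = emeasure m2 (A \<times> Pi\<^sub>E I B)"
  shows "m1 = m2"
proof -
  let ?E = "{a \<times> b | a b. a \<in> sets R \<and> b \<in> prod_algebra I N}"
  let ?\<Omega> = "space R \<times> space (PiM I N)"
  have top: "space (PiM I N) \<in> prod_algebra I N"
    unfolding space_PiM using I by (intro prod_algebraI_finite) auto
  have sub: "?E \<subseteq> Pow ?\<Omega>"
    using sets.sets_into_space prod_algebra_sets_into_space[of I N] by (fastforce simp: space_PiM)
  have "sets (R \<Otimes>\<^sub>M PiM I N) = sets (sigma ?\<Omega> ?E)"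
    by (rule sets_pair_eq[where Ca="{space R}" and Cb="{space (PiM I N)}"])
       (use top prod_algebra_sets_into_space[of I N]
         in \<open>auto simp: sets.sigma_sets_eq sets.space_closed sets_PiM space_PiM\<close>)
  then have gen: "sets (R \<Otimes>\<^sub>M PiM I N) = sigma_sets ?\<Omega> ?E"
    using sub by simp
  show ?thesis
  proof (rule measure_eqI_generator_eq[where E="?E" and \<Omega>="?\<Omega>" and A="\<lambda>_. ?\<Omega>"])
    show "Int_stable ?E"
      using Int_stable_prod_algebra[of I N] unfolding Int_stable_def
      by safe (auto simp: Times_Int_Times)
    show "emeasure m1 X = emeasure m2 X" if "X \<in> ?E" for X
    proof -
      obtain a b where X: "X = a \<times> b" "a \<in> sets R" "b \<in> prod_algebra I N" using \<open>X \<in> ?E\<close> by auto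
      then show ?thesis by (auto elim!: prod_algebraE_all intro!: eq)
    qed
    show "emeasure m1 ?\<Omega> \<noteq> \<infinity>"
      using fin sets_eq_imp_space_eq[OF s1] by (simp add: space_pair_measure)
  qed (use sub gen s1 s2 top in auto)
qed

section \<open>Elementary inequalities and a limit of weighted averages\<close>

lemma abs_le_1_plus_square: "\<bar>x :: real\<bar> \<le> 1 + x\<^sup>2"
proof -
  have "0 \<le> (\<bar>x\<bar> - 1)\<^sup>2" by simp
  then have "2 * \<bar>x\<bar> \<le> 1 + x\<^sup>2" by (simp add: power2_diff)
  then show ?thesis by simp
qed

lemma abs_mult_le_squares: "\<bar>x * y :: real\<bar> \<le> x\<^sup>2 + y\<^sup>2"
  using sum_squares_bound[of "\<bar>x\<bar>" "\<bar>y\<bar>"] mult_nonneg_nonneg[of "\<bar>x\<bar>" "\<bar>y\<bar>"]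
  unfolding abs_mult power2_abs by linarith

text \<open>This is the nonnegativity of the variance of the absolute value of \<open>V\<close>. It
  turns convergence of second moments into convergence in L1.\<close>

lemma (in prob_space) expectation_abs_le_sqrt:
  fixes V :: "'a \<Rightarrow> real"
  assumes [measurable]: "V \<in> borel_measurable M" and i2: "integrable M (\<lambda>\<omega>. (V \<omega>)\<^sup>2)"
  shows "integrable M V" "expectation (\<lambda>\<omega>. \<bar>V \<omega>\<bar>) \<le> sqrt (expectation (\<lambda>\<omega>. (V \<omega>)\<^sup>2))"
proof -
  show "integrable M V"
    by (rule Bochner_Integration.integrable_bound[of M "\<lambda>\<omega>. 1 + (V \<omega>)\<^sup>2"])
       (use i2 abs_le_1_plus_square in auto)
  then have i: "integrable M (\<lambda>\<omega>. \<bar>V \<omega>\<bar>)" by simp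
  have "variance (\<lambda>\<omega>. \<bar>V \<omega>\<bar>) = expectation (\<lambda>\<omega>. \<bar>V \<omega>\<bar>\<^sup>2) - (expectation (\<lambda>\<omega>. \<bar>V \<omega>\<bar>))\<^sup>2"
    by (rule variance_eq[OF i]) (use i2 in simp)
  then have "(expectation (\<lambda>\<omega>. \<bar>V \<omega>\<bar>))\<^sup>2 \<le> expectation (\<lambda>\<omega>. (V \<omega>)\<^sup>2)"
    using variance_positive[of "\<lambda>\<omega>. \<bar>V \<omega>\<bar>"] by simp
  then show "expectation (\<lambda>\<omega>. \<bar>V \<omega>\<bar>) \<le> sqrt (expectation (\<lambda>\<omega>. (V \<omega>)\<^sup>2))"
    by (rule real_le_rsqrt)
qed

lemma norm_integral_le:
  fixes h :: "'b \<Rightarrow> 'c::{banach, second_countable_topology}" and b :: "'b \<Rightarrow> real"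
  assumes "integrable M h" "integrable M b" "\<And>x. norm (h x) \<le> b x"
  shows "norm (\<integral>x. h x \<partial>M) \<le> (\<integral>x. b x \<partial>M)"
  by (rule order_trans[OF integral_norm_bound integral_mono]) (use assms in auto)

lemma exp_minus_approx:
  assumes "0 \<le> (a::real)" shows "\<bar>exp (- a) - (1 - a)\<bar> \<le> a\<^sup>2"
proof -
  have "1 - a \<le> exp (- a)" using exp_ge_add_one_self[of "- a"] by simp
  moreover have "exp (- a) \<le> 1 / (1 + a)"
    using exp_ge_add_one_self[of a] assms by (simp add: exp_minus field_simps)
  \<comment> \<open>The product (1 - a + a^2)(1 + a) equals 1 + a^3.\<close>
  moreover have "1 / (1 + a) \<le> 1 - a + a\<^sup>2"
  proof -
    have "1 \<le> (1 - a + a\<^sup>2) * (1 + a)"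
      using assms by (simp add: algebra_simps power2_eq_square)
    then show ?thesis using assms by (simp add: divide_le_eq)
  qed
  ultimately show ?thesis by simp
qed

lemma exp_minus_lipschitz:
  assumes "0 \<le> (a::real)" "0 \<le> b" shows "\<bar>exp (- a) - exp (- b)\<bar> \<le> \<bar>a - b\<bar>"
proof -
  have *: "exp (- a) - exp (- b) \<le> b - a" if "0 \<le> a" "a \<le> b" for a b :: real
  proof -
    have "exp (- a) - exp (- b) = exp (- a) * (1 - exp (a - b))"
      by (simp add: right_diff_distrib flip: exp_add)
    also have "\<dots> \<le> 1 * (b - a)"
    proof (intro mult_mono)
      show "1 - exp (a - b) \<le> b - a" using exp_ge_add_one_self[of "a - b"] by linarith
    qed (use that in auto)
    finally show ?thesis by simp
  qed
  show ?thesis using assms *[of a b] *[of b a] by (cases "a \<le> b") auto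
qed

text \<open>The weight of any fixed finite set of indices tends to 0, and the remaining terms are
  uniformly small. The weight of \<open>q\<close> is the share of generation \<open>q\<close> in the
  tree.\<close>

lemma weighted_average_tendsto_0:
  fixes e :: "nat \<Rightarrow> real"
  assumes e: "e \<longlonglongrightarrow> 0"
  shows "(\<lambda>r. (\<Sum>q\<le>r. 2 ^ q * e q) / (\<Sum>q\<le>r. 2 ^ q)) \<longlonglongrightarrow> 0"
proof (rule LIMSEQ_I)
  fix d :: real assume d: "0 < d"
  obtain k where k: "\<And>q. k \<le> q \<Longrightarrow> \<bar>e q\<bar> < d / 2" using LIMSEQ_D[OF e, of "d / 2"] d by auto
  \<comment> \<open>\<open>A\<close> is the unnormalised contribution of the finitely many terms
    that need not be small. It does not depend on \<open>r\<close>, whereas the total weight is at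
    least \<open>2 ^ r\<close>.\<close>
  define A where "A = (\<Sum>q<k. 2 ^ q * \<bar>e q\<bar>)"
  have "(\<lambda>r. A / 2 ^ r) \<longlonglongrightarrow> 0" by (rule LIMSEQ_divide_realpow_zero) simp
  from LIMSEQ_D[OF this, of "d / 2"] d obtain r0 where "\<forall>r\<ge>r0. norm (A / 2 ^ r - 0) < d / 2" by auto
  then have r0: "A / 2 ^ r < d / 2" if "r0 \<le> r" for r using that by (intro le_less_trans[OF abs_ge_self[of "A / 2 ^ r"]]) simp
  have "norm ((\<Sum>q\<le>r. 2 ^ q * e q) / (\<Sum>q\<le>r. 2 ^ q) - 0) < d" if r: "max k r0 \<le> r" for r
  proof -
    have S: "(2::real) ^ r \<le> (\<Sum>q\<le>r. 2 ^ q)" by (rule member_le_sum) auto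
    have S0: "0 < (\<Sum>q\<le>r. (2::real) ^ q)" by (rule less_le_trans[OF _ S]) simp
    have "\<bar>\<Sum>q\<le>r. 2 ^ q * e q\<bar> \<le> (\<Sum>q\<le>r. 2 ^ q * \<bar>e q\<bar>)"
      by (rule order_trans[OF sum_abs]) (simp add: abs_mult)
    also have "\<dots> \<le> (\<Sum>q\<le>r. (if q < k then 2 ^ q * \<bar>e q\<bar> else 0) + 2 ^ q * (d / 2))"
      using k d by (intro sum_mono) (auto simp: not_less intro!: mult_left_mono less_imp_le)
    also have "\<dots> = (\<Sum>q\<le>r. if q < k then 2 ^ q * \<bar>e q\<bar> else 0) + (\<Sum>q\<le>r. 2 ^ q) * (d / 2)"
      by (simp add: sum.distrib sum_distrib_right)
    also have "(\<Sum>q\<le>r. if q < k then 2 ^ q * \<bar>e q\<bar> else 0) = A"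
      unfolding A_def using r by (intro sum.mono_neutral_cong_right) auto
    finally have "\<bar>\<Sum>q\<le>r. 2 ^ q * e q\<bar> / (\<Sum>q\<le>r. 2 ^ q) \<le> (A + (\<Sum>q\<le>r. 2 ^ q) * (d / 2)) / (\<Sum>q\<le>r. 2 ^ q)"
      using S0 by (intro divide_right_mono) auto
    also have "\<dots> = A / (\<Sum>q\<le>r. 2 ^ q) + d / 2" using S0 by (simp add: add_divide_distrib)
    also have "A / (\<Sum>q\<le>r. 2 ^ q) \<le> A / 2 ^ r"
      by (intro divide_left_mono S) (auto simp: A_def intro!: sum_nonneg mult_pos_pos S0)
    finally have "\<bar>\<Sum>q\<le>r. 2 ^ q * e q\<bar> / (\<Sum>q\<le>r. 2 ^ q) < d"
      using r0[of r] r by linarith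
    then show ?thesis using S0 by simp
  qed
  then show "\<exists>no. \<forall>r\<ge>no. norm ((\<Sum>q\<le>r. 2 ^ q * e q) / (\<Sum>q\<le>r. 2 ^ q) - 0) < d" by blast
qed

lemma iexp_approx_quadratic:
  "cmod (iexp y - (complex_of_real (1 - y\<^sup>2 / 2) + \<i> * complex_of_real y)) \<le> \<bar>y\<bar> ^ 3"
proof -
  have s: "(\<Sum>j\<le>2. (\<i> * complex_of_real y) ^ j / fact j) = complex_of_real (1 - y\<^sup>2 / 2) + \<i> * complex_of_real y"
    by (simp add: numeral_2_eq_2 power2_eq_square algebra_simps)
  have "Suc 2 = 3" by simp
  then have "cmod (iexp y - (complex_of_real (1 - y\<^sup>2 / 2) + \<i> * complex_of_real y)) \<le> \<bar>y\<bar> ^ 3 / fact 3"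
    using iexp_approx1[of y 2] by (simp only: s)
  also have "\<dots> \<le> \<bar>y\<bar> ^ 3 / 1"
  proof (rule divide_left_mono)
    show "(1::real) \<le> fact 3" by (rule fact_ge_1)
  qed simp_all
  finally show ?thesis by (simp only: div_by_1)
qed

subsection \<open>The kernel \<open>Q\<close> and admissible functions\<close>

locale T_kernel =
  fixes P :: "'a::metric_space \<Rightarrow> ('a \<times> 'a) measure"
  assumes T: "T_transition P"
begin

lemma prob_space_P: "prob_space (P x)"
  and sets_P [measurable_cong, simp]: "sets (P x) = sets (borel \<Otimes>\<^sub>M borel)"
  using T by (simp_all add: T_transition_def)

lemma space_P [simp]: "space (P x) = UNIV"
  using sets_eq_imp_space_eq[OF sets_P] by (simp add: space_pair_measure)

lemma measure_P_UNIV [simp]: "measure (P x) UNIV = 1"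
  using prob_space.prob_space[OF prob_space_P] by simp

lemma P_measurable [measurable]: "P \<in> borel \<rightarrow>\<^sub>M prob_algebra (borel \<Otimes>\<^sub>M borel)"
proof (intro measurable_prob_algebraI prob_space_P measurable_subprob_algebra)
  fix A :: "('a \<times> 'a) set" assume "A \<in> sets (borel \<Otimes>\<^sub>M borel)"
  then have "(\<lambda>x. ennreal (measure (P x) A)) \<in> borel_measurable borel"
    using T by (simp add: T_transition_def)
  moreover have "emeasure (P x) A = ennreal (measure (P x) A)" for x
    using prob_space.finite_measure[OF prob_space_P] by (simp add: finite_measure.emeasure_eq_measure)
  ultimately show "(\<lambda>x. emeasure (P x) A) \<in> borel_measurable borel" by simp
qed (auto intro: prob_space_imp_subprob_space prob_space_P)

text \<open>Writing \<open>Q\<close> as a fair choice between the two marginals of \<open>P\<close> makes the lemmas on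
  \<open>Giry_Monad.bind\<close> available for it.\<close>

definition branch :: "'a \<Rightarrow> bool \<Rightarrow> 'a measure" where
  "branch x b = (if b then P_left P x else P_right P x)"

lemma branch_measurable [measurable]:
  "branch x \<in> measure_pmf (bernoulli_pmf (1/2)) \<rightarrow>\<^sub>M subprob_algebra borel"
  by (auto simp: branch_def P_left_def P_right_def space_subprob_algebra split: if_splits
      intro!: prob_space_imp_subprob_space prob_space.prob_space_distr prob_space_P)

lemma Q_kernel_eq_bind: "Q_kernel P x = Giry_Monad.bind (measure_pmf (bernoulli_pmf (1/2))) (branch x)"
proof (rule measure_eqI)
  show sets: "sets (Q_kernel P x) = sets (Giry_Monad.bind (measure_pmf (bernoulli_pmf (1/2))) (branch x))"
    by (subst sets_bind[where N=borel]) (auto simp: sets_Q_kernel branch_def P_left_def P_right_def)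
  fix B assume "B \<in> sets (Q_kernel P x)"
  then have B: "B \<in> sets borel" by (simp add: sets_Q_kernel)
  have "emeasure (Giry_Monad.bind (measure_pmf (bernoulli_pmf (1/2))) (branch x)) B =
      emeasure (P_left P x) B * ennreal (1/2) + emeasure (P_right P x) B * ennreal (1/2)"
    by (subst emeasure_bind[OF _ branch_measurable B]) (simp_all add: branch_def)
  also have "\<dots> = (emeasure (P_left P x) B + emeasure (P_right P x) B) / 2"
    by (simp add: divide_ennreal_def distrib_right ennreal_divide_numeral flip: inverse_ennreal)
  finally show "emeasure (Q_kernel P x) B = emeasure (Giry_Monad.bind (measure_pmf (bernoulli_pmf (1/2))) (branch x)) B"
    by (simp add: emeasure_Q_kernel B)
qed

lemma nn_integral_Q_kernel:
  assumes [measurable]: "h \<in> borel_measurable borel"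
  shows "(\<integral>\<^sup>+y. h y \<partial>Q_kernel P x) =
    (\<integral>\<^sup>+p. h (fst p) \<partial>P x) * ennreal (1/2) + (\<integral>\<^sup>+p. h (snd p) \<partial>P x) * ennreal (1/2)"
  unfolding Q_kernel_eq_bind
  by (subst nn_integral_bind[OF assms branch_measurable])
     (simp_all add: branch_def P_left_def P_right_def nn_integral_distr)

text \<open>Integrability is read off from the nonnegative integral first, because the formula for a
  composed kernel presupposes it.\<close>

lemma integral_Q_kernel:
  fixes u :: "'a \<Rightarrow> real"
  assumes [measurable]: "u \<in> borel_measurable borel"
    and "integrable (P x) (\<lambda>p. u (fst p))" and "integrable (P x) (\<lambda>p. u (snd p))"
  shows "integrable (Q_kernel P x) u"
    and "(\<integral>y. u y \<partial>Q_kernel P x) = ((\<integral>p. u (fst p) \<partial>P x) + (\<integral>p. u (snd p) \<partial>P x)) / 2"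
proof -
  show i: "integrable (Q_kernel P x) u"
    using assms(2,3) ennreal_less_top[of "1/2"]
    by (auto simp del: ennreal_less_top simp: integrable_iff_bounded nn_integral_Q_kernel sets_Q_kernel ennreal_mult_less_top
        cong: measurable_cong_sets)
  show "(\<integral>y. u y \<partial>Q_kernel P x) = ((\<integral>p. u (fst p) \<partial>P x) + (\<integral>p. u (snd p) \<partial>P x)) / 2"
    using i unfolding Q_kernel_eq_bind
    by (subst integral_bind_integrable(2)[OF branch_measurable])
       (simp_all add: branch_def P_left_def P_right_def integral_distr)
qed

lemma Q_kernel_measurable [measurable]: "Q_kernel P \<in> borel \<rightarrow>\<^sub>M prob_algebra borel"
proof (intro measurable_prob_algebraI measurable_subprob_algebra)
  fix x
  show p: "prob_space (Q_kernel P x)"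
    unfolding Q_kernel_eq_bind
    by (rule measure_pmf.prob_space_bind[OF _ branch_measurable])
       (auto simp: branch_def P_left_def P_right_def intro!: prob_space.prob_space_distr prob_space_P)
  show "subprob_space (Q_kernel P x)" by (rule prob_space_imp_subprob_space[OF p])
next
  fix B :: "'a set" assume [measurable]: "B \<in> sets borel"
  note [measurable] = measurable_prob_algebraD[OF P_measurable]
  have "(\<lambda>x. emeasure (P x) (fst -` B \<inter> space (borel \<Otimes>\<^sub>M borel)) / 2 +
      emeasure (P x) (snd -` B \<inter> space (borel \<Otimes>\<^sub>M borel)) / 2) \<in> borel_measurable borel"
    by measurable
  then show "(\<lambda>x. emeasure (Q_kernel P x) B) \<in> borel_measurable borel"
    by (simp add: emeasure_Q_kernel P_left_def P_right_def emeasure_distr space_pair_measure add_divide_distrib_ennreal)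
qed (auto simp: sets_Q_kernel)

lemma Q_iter_space: "Q_iter P r x \<in> space (prob_algebra borel)"
proof (induction r)
  case 0 then show ?case by (auto simp: space_prob_algebra prob_space_return)
next
  case (Suc r)
  then show ?case
    using prob_space_bind'[OF Suc Q_kernel_measurable] sets_bind'[OF Suc Q_kernel_measurable]
    by (simp add: space_prob_algebra)
qed

lemma sets_Q_iter [measurable_cong, simp]: "sets (Q_iter P r x) = sets borel"
  using Q_iter_space[of r x] by (simp add: space_prob_algebra)

lemma space_Q_iter [simp]: "space (Q_iter P r x) = UNIV"
  using sets_eq_imp_space_eq[OF sets_Q_iter] by simp

text \<open>The operator Q written directly through the two marginals of \<open>P\<close>, so that
  its powers can be taken by function iteration. On \<open>F\<close> it is integration against
  \<open>Q_kernel\<close>.\<close>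

definition Q1 :: "('a \<Rightarrow> real) \<Rightarrow> 'a \<Rightarrow> real" where
  "Q1 u x = ((\<integral>p. u (fst p) \<partial>P x) + (\<integral>p. u (snd p) \<partial>P x)) / 2"

end

locale admissible = T_kernel P for P :: "'a::metric_space \<Rightarrow> ('a \<times> 'a) measure" +
  fixes \<nu> \<mu> :: "'a measure" and F :: "('a \<Rightarrow> real) set"
  assumes adm: "admissible_space P \<nu> \<mu> F"
begin

lemma F_measurable [measurable (raw)]: "u \<in> F \<Longrightarrow> u \<in> borel_measurable borel"
  and F_add: "u \<in> F \<Longrightarrow> w \<in> F \<Longrightarrow> (\<lambda>x. u x + w x) \<in> F"
  and F_scale: "u \<in> F \<Longrightarrow> (\<lambda>x. c * u x) \<in> F"
  and F_const: "(\<lambda>x. c) \<in> F"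
  and F_square: "u \<in> F \<Longrightarrow> (\<lambda>x. (u x)\<^sup>2) \<in> F"
  and F_tensor: "u \<in> F \<Longrightarrow> w \<in> F \<Longrightarrow> P2 P (tensor u w) \<in> F"
  and F_tensor_integrable: "u \<in> F \<Longrightarrow> w \<in> F \<Longrightarrow> integrable (P x) (tensor u w)"
  and prob_space_\<mu>: "prob_space \<mu>"
  and F_integrable_\<mu>: "u \<in> F \<Longrightarrow> integrable \<mu> u"
  and F_integrable_\<nu>: "u \<in> F \<Longrightarrow> integrable \<nu> u"
  using adm unfolding admissible_space_def by auto

lemma F_diff: "u \<in> F \<Longrightarrow> w \<in> F \<Longrightarrow> (\<lambda>x. u x - w x) \<in> F"
  using F_add[OF _ F_scale[of w "-1"]] by simp

text \<open>Tensoring with the constant 1 turns the condition on pairs of functions into a condition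
  on each marginal.\<close>

lemma F_integrable_P:
  assumes "u \<in> F"
  shows "integrable (P x) (\<lambda>p. u (fst p))" "integrable (P x) (\<lambda>p. u (snd p))"
  using F_tensor_integrable[OF assms F_const[of 1]] F_tensor_integrable[OF F_const[of 1] assms]
  by (simp_all add: tensor_def case_prod_unfold)

lemma Q1_F: "u \<in> F \<Longrightarrow> Q1 u \<in> F"
  using F_scale[OF F_add[OF F_tensor[OF _ F_const[of 1]] F_tensor[OF F_const[of 1]]], of u u "1/2"]
  by (simp add: Q1_def[abs_def] P2_def tensor_def case_prod_unfold add_divide_distrib)

lemma Q1_funpow_F: "u \<in> F \<Longrightarrow> (Q1 ^^ r) u \<in> F"
  by (induction r) (auto intro: Q1_F)

lemma integral_Q_kernel_F:
  assumes "u \<in> F"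
  shows "integrable (Q_kernel P x) u" "(\<integral>y. u y \<partial>Q_kernel P x) = Q1 u x"
  using integral_Q_kernel[OF F_measurable[OF assms] F_integrable_P[OF assms]] by (auto simp: Q1_def)

text \<open>The function 1 + u^2 lies in \<open>F\<close>, is nonnegative and dominates
  \<open>u\<close>. Its nonnegative integral over the longer iterate is that of its image under
  \<open>Q1\<close> over the shorter one. The image is again in \<open>F\<close>, hence the
  induction over arbitrary \<open>u\<close>.\<close>

lemma integrable_Q_iter:
  assumes "u \<in> F" shows "integrable (Q_iter P r x) u"
  using assms
proof (induction r arbitrary: u)
  case 0
  then show ?case by (auto simp: integrable_iff_bounded nn_integral_return)
next
  case (Suc r)
  have K: "Q_kernel P \<in> Q_iter P r x \<rightarrow>\<^sub>M subprob_algebra borel"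
    using measurable_prob_algebraD[OF Q_kernel_measurable] by (simp cong: measurable_cong_sets)
  define w where "w x = 1 + (u x)\<^sup>2" for x
  have w: "w \<in> F" unfolding w_def by (intro F_add F_const F_square Suc.prems)
  note [measurable] = F_measurable[OF w] F_measurable[OF Suc.prems]
  have w0: "0 \<le> w y" for y by (simp add: w_def)
  have uw: "\<bar>u y\<bar> \<le> w y" for y
    unfolding w_def by (rule abs_le_1_plus_square)
  have "(\<integral>\<^sup>+y. ennreal (w y) \<partial>Q_iter P (Suc r) x) = (\<integral>\<^sup>+z. \<integral>\<^sup>+y. ennreal (w y) \<partial>Q_kernel P z \<partial>Q_iter P r x)"
    by (simp, rule nn_integral_bind[OF _ K]) measurable
  also have "\<dots> = (\<integral>\<^sup>+z. ennreal (Q1 w z) \<partial>Q_iter P r x)"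
    by (rule nn_integral_cong)
       (use w0 integral_Q_kernel_F[OF w] in \<open>simp add: nn_integral_eq_integral\<close>)
  also have "\<dots> < \<infinity>"
  proof -
    have "0 \<le> Q1 w z" for z unfolding Q1_def by (auto intro!: add_nonneg_nonneg Bochner_Integration.integral_nonneg w0)
    then show ?thesis using Suc.IH[OF Q1_F[OF w]] by (simp add: nn_integral_eq_integral)
  qed
  finally have "integrable (Q_iter P (Suc r) x) w"
    using w0 by (intro integrableI_nonneg) (auto cong: measurable_cong_sets simp del: Q_iter.simps)
  then show ?case
    by (rule Bochner_Integration.integrable_bound) (use uw w0 in \<open>auto cong: measurable_cong_sets simp del: Q_iter.simps\<close>)
qed

text \<open>The last transition is integrated out first, which replaces \<open>u\<close> by
  \<open>Q1 u\<close>. Through this identity the limit and domination conditions on \<open>F\<close>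
  become statements about powers of \<open>Q1\<close>.\<close>

lemma Q_op_eq_funpow:
  assumes "u \<in> F" shows "Q_op P r u = (Q1 ^^ r) u"
  using assms
proof (induction r arbitrary: u)
  case 0
  then show ?case by (simp add: Q_op_def fun_eq_iff integral_return F_measurable)
next
  case (Suc r)
  have K: "Q_kernel P \<in> Q_iter P r x \<rightarrow>\<^sub>M subprob_algebra borel" for x
    using measurable_prob_algebraD[OF Q_kernel_measurable] by (simp cong: measurable_cong_sets)
  have "Q_op P (Suc r) u = Q_op P r (Q1 u)"
    unfolding Q_op_def fun_eq_iff
    using integral_bind_integrable(2)[OF K _ integrable_Q_iter[of u "Suc r", simplified]] Suc.prems
    by (simp add: integral_Q_kernel_F)
  then show ?case using Suc.IH[OF Q1_F[OF Suc.prems]] by (simp add: funpow_swap1)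
qed

lemma Q1_funpow_tendsto:
  "u \<in> F \<Longrightarrow> (\<lambda>r. (Q1 ^^ r) u x) \<longlonglongrightarrow> (\<integral>y. u y \<partial>\<mu>)"
  using adm by (simp add: admissible_space_def flip: Q_op_eq_funpow)

lemma Q1_funpow_bound:
  assumes "u \<in> F" obtains w where "w \<in> F" "\<And>r x. \<bar>(Q1 ^^ r) u x\<bar> \<le> w x"
  using adm assms by (auto simp: admissible_space_def simp flip: Q_op_eq_funpow)

end

subsection \<open>Generations of the tree\<close>

lemma finite_generation [simp]: "finite (generation q)"
  and card_generation: "card (generation q) = 2 ^ q"
  by (simp_all add: generation_def)

lemma generation_nonempty [simp]: "generation q \<noteq> {}"
  by (simp add: generation_def)

lemma generation_0: "generation 0 = {1}"
  by (auto simp: generation_def)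

lemma gen_of_generation:
  assumes "n \<in> generation q" shows "gen_of n = q"
proof -
  have "0 < n" using assms by (auto simp: generation_def intro: less_le_trans[of 0 "2^q"])
  then have "\<lfloor>log (real 2) (real n)\<rfloor> = int q"
    using assms by (subst floor_log_nat_eq_powr_iff) (auto simp: generation_def)
  then show ?thesis by (simp add: gen_of_def)
qed

lemma generation_pos: "n \<in> generation q \<Longrightarrow> 1 \<le> n"
  using one_le_power[of "2::nat" q] by (simp add: generation_def del: one_le_power)

lemma daughters_generation:
  "n \<in> generation q \<Longrightarrow> 2 * n \<in> generation (Suc q)"
  "n \<in> generation q \<Longrightarrow> 2 * n + 1 \<in> generation (Suc q)"
  by (auto simp: generation_def)

text \<open>Parity splits generation q + 1 into first and second daughters, each class being in
  bijection with generation q.\<close>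

lemma sum_generation_Suc:
  "(\<Sum>n\<in>generation (Suc q). h n) = (\<Sum>n\<in>generation q. h (2 * n) + h (2 * n + 1))"
proof -
  have eq: "generation (Suc q) = (\<lambda>n. 2 * n) ` generation q \<union> (\<lambda>n. 2 * n + 1) ` generation q"
  proof (intro equalityI subsetI)
    fix n assume n: "n \<in> generation (Suc q)"
    then have d: "n div 2 \<in> generation q" by (auto simp: generation_def)
    show "n \<in> (\<lambda>n. 2 * n) ` generation q \<union> (\<lambda>n. 2 * n + 1) ` generation q"
    proof (cases "even n")
      case True then have "n = 2 * (n div 2)" by simp
      with d show ?thesis by blast
    next
      case False then have "n = 2 * (n div 2) + 1" by simp
      with d show ?thesis by blast
    qed
  qed (auto intro: daughters_generation daughters_generation[simplified])
  have "(\<lambda>n. 2 * n) ` generation q \<inter> (\<lambda>n. 2 * n + 1) ` generation q = {}"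
    by auto presburger
  then have "(\<Sum>n\<in>generation (Suc q). h n) =
      (\<Sum>n\<in>(\<lambda>n. 2 * n) ` generation q. h n) + (\<Sum>n\<in>(\<lambda>n. 2 * n + 1) ` generation q. h n)"
    unfolding eq by (intro sum.union_disjoint) auto
  also have "\<dots> = (\<Sum>n\<in>generation q. h (2 * n)) + (\<Sum>n\<in>generation q. h (2 * n + 1))"
    by (subst (1 2) sum.reindex) (auto simp: inj_on_def)
  finally show ?thesis by (simp add: sum.distrib)
qed

lemma sum_tree_upto: "(\<Sum>n\<in>tree_upto r. h n) = (\<Sum>q\<le>r. \<Sum>n\<in>generation q. h n)"
  unfolding tree_upto_def
  by (rule sum.UNION_disjoint) (auto dest: gen_of_generation)

lemma card_tree_upto: "card (tree_upto r) = (\<Sum>q\<le>r. 2 ^ q)"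
  using sum_tree_upto[of "\<lambda>_. 1 :: nat" r] by (simp add: card_generation)

lemma real_card_tree_upto: "real (card (tree_upto r)) = (\<Sum>q\<le>r. 2 ^ q)"
  by (simp add: card_tree_upto)

lemma two_power_le_card_tree_upto: "2 ^ r \<le> real (card (tree_upto r))"
  unfolding real_card_tree_upto by (rule member_le_sum) auto

lemma card_tree_upto_pos: "0 < real (card (tree_upto r))"
  by (rule less_le_trans[OF _ two_power_le_card_tree_upto]) simp

lemma filterlim_card_tree_upto: "filterlim (\<lambda>r. real (card (tree_upto r))) at_top sequentially"
proof (rule filterlim_at_top_mono[OF filterlim_real_sequentially])
  have "real r \<le> 2 ^ r" for r using less_exp[of r] by (metis of_nat_le_iff of_nat_numeral of_nat_power less_imp_le)
  then show "\<forall>\<^sub>F r in sequentially. real r \<le> real (card (tree_upto r))"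
    by (intro always_eventually allI order_trans[OF _ two_power_le_card_tree_upto])
qed

subsection \<open>The joint law of a generation and its offspring\<close>

locale bmc = T_kernel P for P :: "'a::metric_space \<Rightarrow> ('a \<times> 'a) measure" +
  fixes M :: "'b measure" and Fl :: "nat \<Rightarrow> 'b measure" and X :: "nat \<Rightarrow> 'b \<Rightarrow> 'a" and \<nu> :: "'a measure"
  assumes chain: "bifurcating_markov_chain M Fl X \<nu> P"
begin

sublocale prob_space M
  using chain by (simp add: bifurcating_markov_chain_def)

lemma subalg: "subalgebra M (Fl q)"
  using chain by (simp add: bifurcating_markov_chain_def)

lemma sets_Fl_mono: "p \<le> q \<Longrightarrow> sets (Fl p) \<subseteq> sets (Fl q)"
  using chain by (auto simp: bifurcating_markov_chain_def filtration_def)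

lemma space_Fl: "space (Fl q) = space M"
  using subalg[of q] by (simp add: subalgebra_def)

lemma X_measurable_Fl: "n \<in> generation q \<Longrightarrow> X n \<in> Fl q \<rightarrow>\<^sub>M borel"
  using chain gen_of_generation[of n q] generation_pos[of n q]
  by (auto simp: bifurcating_markov_chain_def)

lemma measurable_Fl_mono: "f \<in> Fl p \<rightarrow>\<^sub>M N \<Longrightarrow> p \<le> q \<Longrightarrow> f \<in> Fl q \<rightarrow>\<^sub>M N"
  using sets_Fl_mono[of p q] by (auto simp: measurable_def space_Fl)

lemma measurable_Fl: "f \<in> Fl p \<rightarrow>\<^sub>M N \<Longrightarrow> f \<in> M \<rightarrow>\<^sub>M N"
  using measurable_from_subalg[OF subalg] .

definition Y :: "nat \<Rightarrow> 'b \<Rightarrow> 'a \<times> 'a" where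
  "Y n \<omega> = (X (2 * n) \<omega>, X (2 * n + 1) \<omega>)"

lemma Y_measurable_Fl: "n \<in> generation q \<Longrightarrow> Y n \<in> Fl (Suc q) \<rightarrow>\<^sub>M borel \<Otimes>\<^sub>M borel"
  unfolding Y_def[abs_def] by (intro measurable_Pair X_measurable_Fl daughters_generation)

lemma X_measurable: "n \<in> generation q \<Longrightarrow> X n \<in> M \<rightarrow>\<^sub>M borel"
  and Y_measurable: "n \<in> generation q \<Longrightarrow> Y n \<in> M \<rightarrow>\<^sub>M borel \<Otimes>\<^sub>M borel"
  by (blast intro: measurable_Fl X_measurable_Fl Y_measurable_Fl)+

abbreviation R :: "nat \<Rightarrow> 'b measure" where
  "R q \<equiv> restr_to_subalg M (Fl q)"

abbreviation N :: "nat \<Rightarrow> (nat \<Rightarrow> 'a \<times> 'a) measure" where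
  "N q \<equiv> PiM (generation q) (\<lambda>_. borel \<Otimes>\<^sub>M borel)"

text \<open>The candidate for the conditional law of the offspring given \<open>Fl q\<close>:
  independent draws from the mothers' kernels. That it is this law is shown in
  \<open>joint_law\<close>.\<close>

definition K :: "nat \<Rightarrow> 'b \<Rightarrow> (nat \<Rightarrow> 'a \<times> 'a) measure" where
  "K q \<omega> = PiM (generation q) (\<lambda>n. P (X n \<omega>))"

text \<open>The restriction to the generation makes the value a point of the product space
  \<open>N q\<close>.\<close>

definition offspring :: "nat \<Rightarrow> 'b \<Rightarrow> nat \<Rightarrow> 'a \<times> 'a" where
  "offspring q \<omega> = (\<lambda>n\<in>generation q. Y n \<omega>)"

lemma product_prob_space_P: "product_prob_space (\<lambda>n. P (X n \<omega>))"
  by (intro product_prob_spaceI prob_space_P)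

lemma sets_R [measurable_cong, simp]: "sets (R q) = sets (Fl q)"
  by (rule sets_restr_to_subalg[OF subalg])

lemma space_R [simp]: "space (R q) = space M"
  by (rule space_restr_to_subalg)

lemma measurable_R: "f \<in> R q \<rightarrow>\<^sub>M L \<longleftrightarrow> f \<in> Fl q \<rightarrow>\<^sub>M L"
  by (intro iffI) (simp_all cong: measurable_cong_sets)

lemma sets_K [measurable_cong, simp]: "sets (K q \<omega>) = sets (N q)"
  unfolding K_def by (intro sets_PiM_cong) auto

lemma prob_space_K: "prob_space (K q \<omega>)"
  unfolding K_def by (intro prob_space_PiM prob_space_P)

lemma emeasure_K:
  assumes "\<And>n. n \<in> generation q \<Longrightarrow> B n \<in> sets (borel \<Otimes>\<^sub>M borel)"
  shows "emeasure (K q \<omega>) (Pi\<^sub>E (generation q) B) = (\<Prod>n\<in>generation q. emeasure (P (X n \<omega>)) (B n))"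
proof -
  interpret product_prob_space "\<lambda>n. P (X n \<omega>)" "generation q" by (rule product_prob_space_P)
  show ?thesis unfolding K_def using assms by (subst emeasure_PiM) auto
qed

lemma emeasure_P_X_measurable:
  assumes "n \<in> generation q" "B \<in> sets (borel \<Otimes>\<^sub>M borel)"
  shows "(\<lambda>\<omega>. emeasure (P (X n \<omega>)) B) \<in> borel_measurable (Fl q)"
  by (rule measurable_compose[OF X_measurable_Fl[OF assms(1)]],
      rule measurable_compose[OF measurable_prob_algebraD[OF P_measurable]
        measurable_emeasure_subprob_algebra[OF assms(2)]])

text \<open>It suffices to test boxes, which are stable under intersection and generate the
  sigma-field; the mass of a box is a finite product of measurable functions of the mothers.\<close>

lemma K_measurable [measurable]: "K q \<in> R q \<rightarrow>\<^sub>M prob_algebra (N q)"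
proof (rule measurable_prob_algebra_generated[OF sets_PiM Int_stable_prod_algebra
      prod_algebra_sets_into_space])
  fix A assume "A \<in> prod_algebra (generation q) (\<lambda>_. (borel \<Otimes>\<^sub>M borel) :: ('a \<times> 'a) measure)"
  then obtain B where B: "A = Pi\<^sub>E (generation q) B" "\<And>n. n \<in> generation q \<Longrightarrow> B n \<in> sets (borel \<Otimes>\<^sub>M borel)"
    by (auto elim!: prod_algebraE_all)
  show "(\<lambda>\<omega>. emeasure (K q \<omega>) A) \<in> borel_measurable (R q)"
    using B by (simp add: emeasure_K measurable_R borel_measurable_prod_ennreal emeasure_P_X_measurable)
qed (auto simp: prob_space_K)

lemma offspring_measurable: "offspring q \<in> M \<rightarrow>\<^sub>M N q"
  unfolding offspring_def[abs_def] by (intro measurable_restrict Y_measurable)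

lemma Pair_kernel_measurable [measurable]:
  "(\<lambda>\<omega>. distr (K q \<omega>) (R q \<Otimes>\<^sub>M N q) (Pair \<omega>)) \<in> R q \<rightarrow>\<^sub>M subprob_algebra (R q \<Otimes>\<^sub>M N q)"
  by (rule measurable_distr2[where M="N q"])
     (auto intro: measurable_prob_algebraD[OF K_measurable])

lemma id_measurable_R: "(\<lambda>\<omega>. \<omega>) \<in> M \<rightarrow>\<^sub>M R q"
  using subalg[of q] by (auto simp: measurable_def subalgebra_def)

lemma graph_measurable: "(\<lambda>\<omega>. (\<omega>, offspring q \<omega>)) \<in> M \<rightarrow>\<^sub>M R q \<Otimes>\<^sub>M N q"
  by (intro measurable_Pair id_measurable_R offspring_measurable)

text \<open>The product formula defining the chain enters the proof here, for indicator functions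
  and integrated over an event of the past.\<close>

lemma integral_prod_measure:
  assumes A: "A \<in> sets (Fl q)"
    and B: "\<And>n. n \<in> generation q \<Longrightarrow> B n \<in> sets (borel \<Otimes>\<^sub>M borel)"
  shows "(\<integral>\<omega>\<in>A. (\<Prod>n\<in>generation q. indicator (B n) (Y n \<omega>)) \<partial>M) =
    (\<integral>\<omega>\<in>A. (\<Prod>n\<in>generation q. measure (P (X n \<omega>)) (B n)) \<partial>M)"
proof -
  interpret S: sigma_finite_subalgebra M "Fl q"
    using finite_measure_subalgebra_is_sigma_finite[of M "Fl q"] finite_measure_axioms subalg
    by (simp add: finite_measure_subalgebra_def finite_measure_subalgebra_axioms_def)
  have AE: "AE \<omega> in M. real_cond_exp M (Fl q)
           (\<lambda>\<omega>. \<Prod>n\<in>generation q. indicat_real (B n) (X (2 * n) \<omega>, X (2 * n + 1) \<omega>)) \<omega> =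
         (\<Prod>n\<in>generation q. P2 P (indicat_real (B n)) (X n \<omega>))"
  proof -
    have "\<forall>n\<in>generation q. indicat_real (B n) \<in> borel_measurable (borel \<Otimes>\<^sub>M borel) \<and>
        bounded (range (indicat_real (B n)))"
      using B by (auto intro!: boundedI[where B=1] simp: indicator_def)
    then show ?thesis
      by (rule chain[unfolded bifurcating_markov_chain_def, THEN conjunct2, THEN conjunct2, THEN conjunct2,
            THEN conjunct2, THEN conjunct2, THEN conjunct2, THEN spec, THEN spec, THEN mp])
  qed
  have int: "integrable M (\<lambda>\<omega>. \<Prod>n\<in>generation q. indicat_real (B n) (Y n \<omega>))"
  proof (rule integrable_const_bound[where B=1])
    show "(\<lambda>\<omega>. \<Prod>n\<in>generation q. indicat_real (B n) (Y n \<omega>)) \<in> borel_measurable M"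
      using B by (intro borel_measurable_prod measurable_compose[OF Y_measurable]) auto
  qed (auto simp: abs_prod intro!: prod_le_1)
  have AM: "A \<in> sets M" using A subalg[of q] by (auto simp: subalgebra_def)
  have "(\<integral>\<omega>\<in>A. (\<Prod>n\<in>generation q. indicator (B n) (Y n \<omega>)) \<partial>M) =
    (\<integral>\<omega>\<in>A. real_cond_exp M (Fl q) (\<lambda>\<omega>. \<Prod>n\<in>generation q. indicator (B n) (Y n \<omega>)) \<omega> \<partial>M)"
    by (rule S.real_cond_exp_intA[OF int A])
  also have "\<dots> = (\<integral>\<omega>\<in>A. (\<Prod>n\<in>generation q. measure (P (X n \<omega>)) (B n)) \<partial>M)"
  proof (rule set_lebesgue_integral_cong_AE)
    show "AE \<omega>\<in>A in M. real_cond_exp M (Fl q) (\<lambda>\<omega>. \<Prod>n\<in>generation q. indicator (B n) (Y n \<omega>)) \<omega> =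
        (\<Prod>n\<in>generation q. measure (P (X n \<omega>)) (B n))"
      using AE by eventually_elim (simp add: Y_def P2_def B)
    show "(\<lambda>\<omega>. \<Prod>n\<in>generation q. measure (P (X n \<omega>)) (B n)) \<in> borel_measurable M"
      unfolding measure_def
      by (intro borel_measurable_prod measurable_compose[OF measurable_Fl[OF emeasure_P_X_measurable]] B) auto
  qed (use AM in auto)
  finally show ?thesis .
qed

text \<open>On rectangles the equality is \<open>integral_prod_measure\<close>, and rectangles
  determine the law. The identity extends the defining property from bounded products to arbitrary
  integrable functions of the past and the offspring.\<close>

lemma joint_law:
  "distr M (R q \<Otimes>\<^sub>M N q) (\<lambda>\<omega>. (\<omega>, offspring q \<omega>)) =
    Giry_Monad.bind (R q) (\<lambda>\<omega>. distr (K q \<omega>) (R q \<Otimes>\<^sub>M N q) (Pair \<omega>))"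
proof (rule measure_eqI_pair_PiM[where R="R q" and I="generation q" and N="\<lambda>_. borel \<Otimes>\<^sub>M borel"])
  let ?T = "Giry_Monad.bind (R q) (\<lambda>\<omega>. distr (K q \<omega>) (R q \<Otimes>\<^sub>M N q) (Pair \<omega>))"
  have ne: "space (R q) \<noteq> {}" by (simp add: not_empty)
  show "sets ?T = sets (R q \<Otimes>\<^sub>M N q)" by (rule sets_bind) (auto simp: not_empty)
  interpret D: prob_space "distr M (R q \<Otimes>\<^sub>M N q) (\<lambda>\<omega>. (\<omega>, offspring q \<omega>))"
    by (rule prob_space_distr[OF graph_measurable])
  show "emeasure (distr M (R q \<Otimes>\<^sub>M N q) (\<lambda>\<omega>. (\<omega>, offspring q \<omega>)))
      (space (distr M (R q \<Otimes>\<^sub>M N q) (\<lambda>\<omega>. (\<omega>, offspring q \<omega>)))) \<noteq> \<infinity>"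
    using D.emeasure_finite by simp
  fix A :: "'b set" and B :: "nat \<Rightarrow> ('a \<times> 'a) set"
  assume "A \<in> sets (R q)" and B: "\<And>n. n \<in> generation q \<Longrightarrow> B n \<in> sets (borel \<Otimes>\<^sub>M borel)"
  then have A: "A \<in> sets (Fl q)" by simp
  then have AM: "A \<in> sets M" using subalg[of q] by (auto simp: subalgebra_def)
  have Bs: "Pi\<^sub>E (generation q) B \<in> sets (N q)" using B by (intro sets_PiM_I_finite) auto
  have ABs: "A \<times> Pi\<^sub>E (generation q) B \<in> sets (R q \<Otimes>\<^sub>M N q)" using A Bs by (intro pair_measureI) auto
  let ?S = "A \<inter> {\<omega>\<in>space M. \<forall>n\<in>generation q. Y n \<omega> \<in> B n}"
  have Ssets: "?S \<in> sets M"
    using B by (intro sets.Int[OF AM] sets.sets_Collect_finite_All' measurable_sets_Collect[OF Y_measurable]) 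
      (auto)
  have "emeasure (distr M (R q \<Otimes>\<^sub>M N q) (\<lambda>\<omega>. (\<omega>, offspring q \<omega>))) (A \<times> Pi\<^sub>E (generation q) B) = emeasure M ?S"
    by (subst emeasure_distr[OF graph_measurable ABs])
       (auto intro!: arg_cong[where f="emeasure M"] simp: offspring_def PiE_iff)
  also have "\<dots> = ennreal (measure M ?S)" by (simp add: emeasure_eq_measure)
  also have "measure M ?S = (\<integral>\<omega>\<in>A. (\<Prod>n\<in>generation q. indicator (B n) (Y n \<omega>)) \<partial>M)"
  proof -
    have "measure M ?S = (\<integral>\<omega>. indicator ?S \<omega> \<partial>M)" using Ssets by simp
    also have "\<dots> = (\<integral>\<omega>\<in>A. (\<Prod>n\<in>generation q. indicator (B n) (Y n \<omega>)) \<partial>M)"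
      unfolding set_lebesgue_integral_def
      by (intro Bochner_Integration.integral_cong refl)
         (auto simp: indicator_def prod_zero_iff split: if_splits)
    finally show ?thesis .
  qed
  also have "\<dots> = (\<integral>\<omega>\<in>A. (\<Prod>n\<in>generation q. measure (P (X n \<omega>)) (B n)) \<partial>M)"
    by (rule integral_prod_measure[OF A B])
  also have "ennreal \<dots> = (\<integral>\<^sup>+\<omega>. indicator A \<omega> * (\<Prod>n\<in>generation q. emeasure (P (X n \<omega>)) (B n)) \<partial>M)"
  proof -
    have m: "(\<lambda>\<omega>. \<Prod>n\<in>generation q. measure (P (X n \<omega>)) (B n)) \<in> borel_measurable M"
      unfolding measure_def
      by (intro borel_measurable_prod measurable_compose[OF measurable_Fl[OF emeasure_P_X_measurable]] B) auto
    have le1: "(\<Prod>n\<in>generation q. measure (P (X n \<omega>)) (B n)) \<le> 1" for \<omega>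
      using prob_space.prob_le_1[OF prob_space_P] by (intro prod_le_1) auto
    have "integrable M (\<lambda>\<omega>. indicator A \<omega> *\<^sub>R (\<Prod>n\<in>generation q. measure (P (X n \<omega>)) (B n)))"
      using m AM le1 by (intro integrable_const_bound[where B=1])
        (auto simp: indicator_def abs_prod)
    then have "ennreal (\<integral>\<omega>\<in>A. (\<Prod>n\<in>generation q. measure (P (X n \<omega>)) (B n)) \<partial>M) =
       (\<integral>\<^sup>+\<omega>. ennreal (indicator A \<omega> *\<^sub>R (\<Prod>n\<in>generation q. measure (P (X n \<omega>)) (B n))) \<partial>M)"
      unfolding set_lebesgue_integral_def
      by (intro nn_integral_eq_integral[symmetric] AE_I2) (auto intro!: mult_nonneg_nonneg prod_nonneg)
    also have "\<dots> = (\<integral>\<^sup>+\<omega>. indicator A \<omega> * (\<Prod>n\<in>generation q. emeasure (P (X n \<omega>)) (B n)) \<partial>M)"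
      using prob_space.finite_measure[OF prob_space_P]
      by (intro nn_integral_cong)
         (auto simp: indicator_def prod_ennreal finite_measure.emeasure_eq_measure)
    finally show ?thesis .
  qed
  \<comment> \<open>The integrand depends on the past only, so \<open>M\<close> may be replaced by
    its restriction to \<open>Fl q\<close>.\<close>
  also have "\<dots> = (\<integral>\<^sup>+\<omega>. indicator A \<omega> * (\<Prod>n\<in>generation q. emeasure (P (X n \<omega>)) (B n)) \<partial>R q)"
    using A B by (intro nn_integral_subalgebra2[OF subalg, symmetric] borel_measurable_times_ennreal
        borel_measurable_prod_ennreal emeasure_P_X_measurable) auto
  also have "\<dots> = (\<integral>\<^sup>+\<omega>. emeasure (distr (K q \<omega>) (R q \<Otimes>\<^sub>M N q) (Pair \<omega>)) (A \<times> Pi\<^sub>E (generation q) B) \<partial>R q)"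
  proof (rule nn_integral_cong)
    fix \<omega> assume w: "\<omega> \<in> space (R q)"
    have "emeasure (distr (K q \<omega>) (R q \<Otimes>\<^sub>M N q) (Pair \<omega>)) (A \<times> Pi\<^sub>E (generation q) B) =
        emeasure (K q \<omega>) (Pair \<omega> -` (A \<times> Pi\<^sub>E (generation q) B) \<inter> space (K q \<omega>))"
      by (rule emeasure_distr[OF _ ABs]) (use w in simp)
    \<comment> \<open>The section of the rectangle is the full box or empty, which produces the
      indicator of \<open>A\<close>.\<close>
    also have "Pair \<omega> -` (A \<times> Pi\<^sub>E (generation q) B) \<inter> space (K q \<omega>) = (if \<omega> \<in> A then Pi\<^sub>E (generation q) B else {})"
      using sets.sets_into_space[OF Bs] sets_eq_imp_space_eq[OF sets_K[of q \<omega>]] by auto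
    finally show "indicator A \<omega> * (\<Prod>n\<in>generation q. emeasure (P (X n \<omega>)) (B n)) =
        emeasure (distr (K q \<omega>) (R q \<Otimes>\<^sub>M N q) (Pair \<omega>)) (A \<times> Pi\<^sub>E (generation q) B)"
      by (simp add: emeasure_K B)
  qed
  also have "\<dots> = emeasure ?T (A \<times> Pi\<^sub>E (generation q) B)"
    by (rule emeasure_bind[OF ne Pair_kernel_measurable ABs, symmetric])
  finally show "emeasure (distr M (R q \<Otimes>\<^sub>M N q) (\<lambda>\<omega>. (\<omega>, offspring q \<omega>))) (A \<times> Pi\<^sub>E (generation q) B) =
    emeasure ?T (A \<times> Pi\<^sub>E (generation q) B)" .
qed simp_all

text \<open>The tower property as a disintegration: the inner integral over \<open>K q\<close> takes
  the place of a conditional expectation and is defined at every point.\<close>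

lemma integral_joint:
  fixes H :: "'b \<times> (nat \<Rightarrow> 'a \<times> 'a) \<Rightarrow> real"
  assumes H [measurable]: "H \<in> borel_measurable (R q \<Otimes>\<^sub>M N q)"
    and int: "integrable M (\<lambda>\<omega>. H (\<omega>, offspring q \<omega>))"
  shows "integrable M (\<lambda>\<omega>. \<integral>y. H (\<omega>, y) \<partial>K q \<omega>)"
    and "(\<integral>\<omega>. H (\<omega>, offspring q \<omega>) \<partial>M) = (\<integral>\<omega>. (\<integral>y. H (\<omega>, y) \<partial>K q \<omega>) \<partial>M)"
proof -
  have i: "integrable (Giry_Monad.bind (R q) (\<lambda>\<omega>. distr (K q \<omega>) (R q \<Otimes>\<^sub>M N q) (Pair \<omega>))) H"
    using int by (simp add: integrable_distr_eq[OF graph_measurable H] flip: joint_law)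
  have ne: "space (R q) \<noteq> {}" by (simp add: not_empty)
  note b = integral_bind_integrable[OF Pair_kernel_measurable ne i]
  have e: "(\<integral>z. H z \<partial>distr (K q \<omega>) (R q \<Otimes>\<^sub>M N q) (Pair \<omega>)) = (\<integral>y. H (\<omega>, y) \<partial>K q \<omega>)"
    if "\<omega> \<in> space (R q)" for \<omega>
    using that by (intro integral_distr) auto
  have iR: "integrable (R q) (\<lambda>\<omega>. \<integral>y. H (\<omega>, y) \<partial>K q \<omega>)"
    using b(1) by (subst Bochner_Integration.integrable_cong[OF refl e[symmetric]])
  then show "integrable M (\<lambda>\<omega>. \<integral>y. H (\<omega>, y) \<partial>K q \<omega>)"
    by (rule integrable_from_subalg[OF subalg])
  have "(\<integral>\<omega>. H (\<omega>, offspring q \<omega>) \<partial>M) =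
      (\<integral>z. H z \<partial>distr M (R q \<Otimes>\<^sub>M N q) (\<lambda>\<omega>. (\<omega>, offspring q \<omega>)))"
    by (rule integral_distr[OF graph_measurable H, symmetric])
  also have "\<dots> = (\<integral>\<omega>. (\<integral>y. H (\<omega>, y) \<partial>K q \<omega>) \<partial>R q)"
    unfolding joint_law b(2) by (rule Bochner_Integration.integral_cong[OF refl e])
  also have "\<dots> = (\<integral>\<omega>. (\<integral>y. H (\<omega>, y) \<partial>K q \<omega>) \<partial>M)"
    using borel_measurable_integrable[OF iR]
    by (intro integral_subalgebra2[OF subalg]) (simp add: measurable_R)
  finally show "(\<integral>\<omega>. H (\<omega>, offspring q \<omega>) \<partial>M) = (\<integral>\<omega>. (\<integral>y. H (\<omega>, y) \<partial>K q \<omega>) \<partial>M)" .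
qed

section \<open>Expectations of products over the offspring of one generation\<close>

text \<open>With the past fixed, \<open>Z\<close> is a constant and the remaining product factorises
  over the independent draws. This is the form needed for characteristic functions, where
  \<open>Z\<close> carries the earlier generations.\<close>

lemma integral_prod_offspring_complex:
  fixes Z :: "'b \<Rightarrow> complex" and h :: "nat \<Rightarrow> 'a \<times> 'a \<times> 'a \<Rightarrow> complex"
  assumes Z: "Z \<in> borel_measurable (Fl q)" and Z1: "\<And>\<omega>. cmod (Z \<omega>) \<le> 1"
    and h [measurable]: "\<And>n. h n \<in> borel_measurable (borel \<Otimes>\<^sub>M (borel \<Otimes>\<^sub>M borel))"
    and h1: "\<And>n t. cmod (h n t) \<le> 1"
  defines "\<phi> \<equiv> \<lambda>n \<omega>. \<integral>p. h n (X n \<omega>, p) \<partial>P (X n \<omega>)"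
  shows "integrable M (\<lambda>\<omega>. Z \<omega> * (\<Prod>n\<in>generation q. \<phi> n \<omega>))"
    and "(\<integral>\<omega>. Z \<omega> * (\<Prod>n\<in>generation q. h n (X n \<omega>, Y n \<omega>)) \<partial>M) =
      (\<integral>\<omega>. Z \<omega> * (\<Prod>n\<in>generation q. \<phi> n \<omega>) \<partial>M)"
proof -
  define H where "H = (\<lambda>z. Z (fst z) * (\<Prod>n\<in>generation q. h n (X n (fst z), snd z n)))"
  have [measurable]: "Z \<in> borel_measurable (R q)" using Z by (simp add: measurable_R)
  have [measurable]: "X n \<in> R q \<rightarrow>\<^sub>M borel" if "n \<in> generation q" for n
    using X_measurable_Fl[OF that] by (simp add: measurable_R)
  have Hm [measurable]: "H \<in> borel_measurable (R q \<Otimes>\<^sub>M N q)"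
    unfolding H_def by measurable
  have "cmod (\<Prod>n\<in>generation q. h n (X n (fst z), snd z n)) \<le> 1" for z
    unfolding prod_norm[symmetric] by (intro prod_le_1 conjI norm_ge_zero h1)
  then have H1: "cmod (H z) \<le> 1" for z
    unfolding H_def norm_mult by (intro mult_le_one Z1) auto
  have Ho: "H (\<omega>, offspring q \<omega>) = Z \<omega> * (\<Prod>n\<in>generation q. h n (X n \<omega>, Y n \<omega>))" for \<omega>
    by (simp add: H_def offspring_def)
  have HM: "(\<lambda>\<omega>. H (\<omega>, offspring q \<omega>)) \<in> borel_measurable M"
    by (rule measurable_compose[OF graph_measurable Hm])
  have intM: "integrable M (\<lambda>\<omega>. H (\<omega>, offspring q \<omega>))"
    using HM H1 by (intro integrable_const_bound[where B=1]) auto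
  have intK: "integrable (K q \<omega>) (\<lambda>y. H (\<omega>, y))" if "\<omega> \<in> space M" for \<omega>
  proof -
    interpret k: prob_space "K q \<omega>" by (rule prob_space_K)
    show ?thesis using that H1 by (intro k.integrable_const_bound[where B=1]) auto
  qed
  have inner: "(\<integral>y. H (\<omega>, y) \<partial>K q \<omega>) = Z \<omega> * (\<Prod>n\<in>generation q. \<phi> n \<omega>)" for \<omega>
  proof -
    interpret product_prob_space "\<lambda>n. P (X n \<omega>)" "generation q" by (rule product_prob_space_P)
    have "integrable (P (X n \<omega>)) (\<lambda>p. h n (X n \<omega>, p))" for n
      using h1 by (intro M.integrable_const_bound[where B=1]) auto
    then have "(\<integral>y. (\<Prod>n\<in>generation q. h n (X n \<omega>, y n)) \<partial>K q \<omega>) = (\<Prod>n\<in>generation q. \<phi> n \<omega>)"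
      unfolding K_def \<phi>_def by (intro product_integral_prod) auto
    then show ?thesis by (simp add: H_def)
  qed
  \<comment> \<open>The disintegration is available for real functions, hence the separate treatment
    of real and imaginary parts.\<close>
  have re: "(\<integral>y. Re (H (\<omega>, y)) \<partial>K q \<omega>) = Re (Z \<omega> * (\<Prod>n\<in>generation q. \<phi> n \<omega>))"
    and im: "(\<integral>y. Im (H (\<omega>, y)) \<partial>K q \<omega>) = Im (Z \<omega> * (\<Prod>n\<in>generation q. \<phi> n \<omega>))"
    if "\<omega> \<in> space M" for \<omega>
    using intK[OF that] by (simp_all add: inner)
  have Re: "integrable M (\<lambda>\<omega>. Re (Z \<omega> * (\<Prod>n\<in>generation q. \<phi> n \<omega>)))"
       "(\<integral>\<omega>. Re (H (\<omega>, offspring q \<omega>)) \<partial>M) = (\<integral>\<omega>. Re (Z \<omega> * (\<Prod>n\<in>generation q. \<phi> n \<omega>)) \<partial>M)"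
    using integral_joint[of "\<lambda>z. Re (H z)" q] intM re
    by (simp_all cong: Bochner_Integration.integrable_cong Bochner_Integration.integral_cong)
  have Im: "integrable M (\<lambda>\<omega>. Im (Z \<omega> * (\<Prod>n\<in>generation q. \<phi> n \<omega>)))"
       "(\<integral>\<omega>. Im (H (\<omega>, offspring q \<omega>)) \<partial>M) = (\<integral>\<omega>. Im (Z \<omega> * (\<Prod>n\<in>generation q. \<phi> n \<omega>)) \<partial>M)"
    using integral_joint[of "\<lambda>z. Im (H z)" q] intM im
    by (simp_all cong: Bochner_Integration.integrable_cong Bochner_Integration.integral_cong)
  have c: "integrable M (\<lambda>\<omega>. Complex (Re (Z \<omega> * (\<Prod>n\<in>generation q. \<phi> n \<omega>))) (Im (Z \<omega> * (\<Prod>n\<in>generation q. \<phi> n \<omega>))))"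
    using Re(1) Im(1) unfolding Complex_eq by (intro Bochner_Integration.integrable_add integrable_mult_right integrable_of_real)
  then show i: "integrable M (\<lambda>\<omega>. Z \<omega> * (\<Prod>n\<in>generation q. \<phi> n \<omega>))" by (simp only: complex.collapse)
  show "(\<integral>\<omega>. Z \<omega> * (\<Prod>n\<in>generation q. h n (X n \<omega>, Y n \<omega>)) \<partial>M) =
      (\<integral>\<omega>. Z \<omega> * (\<Prod>n\<in>generation q. \<phi> n \<omega>) \<partial>M)"
    using Re(2) Im(2) intM i unfolding Ho by (intro complex_eqI) (simp_all only: integral_Re integral_Im)
qed

lemma integral_prod_offspring:
  fixes h :: "nat \<Rightarrow> 'a \<times> 'a \<Rightarrow> real"
  assumes h [measurable]: "\<And>n. h n \<in> borel_measurable (borel \<Otimes>\<^sub>M borel)"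
    and hP: "\<And>n x. integrable (P x) (h n)"
    and int: "integrable M (\<lambda>\<omega>. \<Prod>n\<in>generation q. h n (Y n \<omega>))"
  shows "integrable M (\<lambda>\<omega>. \<Prod>n\<in>generation q. P2 P (h n) (X n \<omega>))"
    and "(\<integral>\<omega>. (\<Prod>n\<in>generation q. h n (Y n \<omega>)) \<partial>M) =
      (\<integral>\<omega>. (\<Prod>n\<in>generation q. P2 P (h n) (X n \<omega>)) \<partial>M)"
proof -
  define H :: "'b \<times> (nat \<Rightarrow> 'a \<times> 'a) \<Rightarrow> real" where "H = (\<lambda>z. \<Prod>n\<in>generation q. h n (snd z n))"
  have Hm: "H \<in> borel_measurable (R q \<Otimes>\<^sub>M N q)"
    unfolding H_def by measurable
  have Ho: "H (\<omega>, offspring q \<omega>) = (\<Prod>n\<in>generation q. h n (Y n \<omega>))" for \<omega>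
    by (simp add: H_def offspring_def)
  have inner: "(\<integral>y. H (\<omega>, y) \<partial>K q \<omega>) = (\<Prod>n\<in>generation q. P2 P (h n) (X n \<omega>))" for \<omega>
  proof -
    interpret product_prob_space "\<lambda>n. P (X n \<omega>)" "generation q" by (rule product_prob_space_P)
    show ?thesis unfolding H_def K_def P2_def snd_conv
      by (intro product_integral_prod hP) auto
  qed
  show "integrable M (\<lambda>\<omega>. \<Prod>n\<in>generation q. P2 P (h n) (X n \<omega>))"
    and "(\<integral>\<omega>. (\<Prod>n\<in>generation q. h n (Y n \<omega>)) \<partial>M) =
      (\<integral>\<omega>. (\<Prod>n\<in>generation q. P2 P (h n) (X n \<omega>)) \<partial>M)"
    using integral_joint[OF Hm] int by (simp_all add: Ho inner)
qed

lemma P2_const_1: "P2 P (\<lambda>p. 1) x = 1"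
  using prob_space.prob_space[OF prob_space_P] by (simp add: P2_def)

lemma integral_offspring:
  fixes h :: "'a \<times> 'a \<Rightarrow> real"
  assumes n: "n \<in> generation q" and h: "h \<in> borel_measurable (borel \<Otimes>\<^sub>M borel)"
    and hP: "\<And>x. integrable (P x) h" and int: "integrable M (\<lambda>\<omega>. h (Y n \<omega>))"
  shows "integrable M (\<lambda>\<omega>. P2 P h (X n \<omega>))"
    and "(\<integral>\<omega>. h (Y n \<omega>) \<partial>M) = (\<integral>\<omega>. P2 P h (X n \<omega>) \<partial>M)"
proof -
  \<comment> \<open>All other mothers receive the factor 1, which \<open>P2\<close>
    preserves.\<close>
  define k where "k i = (if i = n then h else (\<lambda>p. 1))" for i
  have e1: "(\<Prod>i\<in>generation q. k i (Y i \<omega>)) = h (Y n \<omega>)"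
    and e2: "(\<Prod>i\<in>generation q. P2 P (k i) (X i \<omega>)) = P2 P h (X n \<omega>)" for \<omega>
    using n by (auto simp: k_def if_distrib[of "\<lambda>f. f _"] if_distrib[of "P2 P"] if_distribR P2_const_1 prod.delta cong: if_cong)
  have km: "k i \<in> borel_measurable (borel \<Otimes>\<^sub>M borel)" for i using h by (simp add: k_def)
  have ki: "integrable (P x) (k i)" for i x
    using hP prob_space.finite_measure[OF prob_space_P] by (simp add: k_def finite_measure.integrable_const)
  show "integrable M (\<lambda>\<omega>. P2 P h (X n \<omega>))"
    and "(\<integral>\<omega>. h (Y n \<omega>) \<partial>M) = (\<integral>\<omega>. P2 P h (X n \<omega>) \<partial>M)"
    using integral_prod_offspring[of k q, OF km ki] int by (simp_all add: e1 e2)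
qed

text \<open>Conditional independence of the offspring of two distinct mothers, obtained by giving
  the factor 1 to all the others.\<close>

lemma integral_offspring_mult:
  fixes h :: "'a \<times> 'a \<Rightarrow> real"
  assumes ij: "i \<in> generation q" "j \<in> generation q" "i \<noteq> j"
    and h: "h \<in> borel_measurable (borel \<Otimes>\<^sub>M borel)"
    and hP: "\<And>x. integrable (P x) h" and int: "integrable M (\<lambda>\<omega>. h (Y i \<omega>) * h (Y j \<omega>))"
  shows "integrable M (\<lambda>\<omega>. P2 P h (X i \<omega>) * P2 P h (X j \<omega>))"
    and "(\<integral>\<omega>. h (Y i \<omega>) * h (Y j \<omega>) \<partial>M) = (\<integral>\<omega>. P2 P h (X i \<omega>) * P2 P h (X j \<omega>) \<partial>M)"
proof -
  define k where "k n = (if n \<in> {i, j} then h else (\<lambda>p. 1))" for n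
  have sub: "{i, j} \<subseteq> generation q" using ij by auto
  have e1: "(\<Prod>n\<in>generation q. k n (Y n \<omega>)) = h (Y i \<omega>) * h (Y j \<omega>)"
    and e2: "(\<Prod>n\<in>generation q. P2 P (k n) (X n \<omega>)) = P2 P h (X i \<omega>) * P2 P h (X j \<omega>)" for \<omega>
  proof -
    have "(\<Prod>n\<in>generation q. k n (Y n \<omega>)) = (\<Prod>n\<in>{i, j}. k n (Y n \<omega>))"
      by (rule prod.mono_neutral_right[OF _ sub]) (auto simp: k_def)
    then show "(\<Prod>n\<in>generation q. k n (Y n \<omega>)) = h (Y i \<omega>) * h (Y j \<omega>)"
      using ij by (simp add: k_def)
    have "(\<Prod>n\<in>generation q. P2 P (k n) (X n \<omega>)) = (\<Prod>n\<in>{i, j}. P2 P (k n) (X n \<omega>))"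
      by (rule prod.mono_neutral_right[OF _ sub]) (auto simp: k_def P2_const_1)
    then show "(\<Prod>n\<in>generation q. P2 P (k n) (X n \<omega>)) = P2 P h (X i \<omega>) * P2 P h (X j \<omega>)"
      using ij by (simp add: k_def)
  qed
  have km: "k n \<in> borel_measurable (borel \<Otimes>\<^sub>M borel)" for n using h by (simp add: k_def)
  have ki: "integrable (P x) (k n)" for n x
    using hP prob_space.finite_measure[OF prob_space_P] by (simp add: k_def finite_measure.integrable_const)
  show "integrable M (\<lambda>\<omega>. P2 P h (X i \<omega>) * P2 P h (X j \<omega>))"
    and "(\<integral>\<omega>. h (Y i \<omega>) * h (Y j \<omega>) \<partial>M) = (\<integral>\<omega>. P2 P h (X i \<omega>) * P2 P h (X j \<omega>) \<partial>M)"
    using integral_prod_offspring[of k q, OF km ki] int by (simp_all add: e1 e2)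
qed

text \<open>Being free of integrability assumptions, this version can establish integrability along
  the tree in \<open>integrable_X\<close>.\<close>

lemma nn_integral_offspring:
  assumes n: "n \<in> generation q" and h [measurable]: "h \<in> borel_measurable (borel \<Otimes>\<^sub>M borel)"
  shows "(\<integral>\<^sup>+\<omega>. h (Y n \<omega>) \<partial>M) = (\<integral>\<^sup>+\<omega>. \<integral>\<^sup>+p. h p \<partial>P (X n \<omega>) \<partial>M)"
proof -
  have [measurable]: "(\<lambda>z. h (snd z n)) \<in> borel_measurable (R q \<Otimes>\<^sub>M N q)" using n by measurable
  have "(\<integral>\<^sup>+\<omega>. h (Y n \<omega>) \<partial>M) = (\<integral>\<^sup>+z. h (snd z n) \<partial>distr M (R q \<Otimes>\<^sub>M N q) (\<lambda>\<omega>. (\<omega>, offspring q \<omega>)))"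
    using n by (subst nn_integral_distr[OF graph_measurable]) (simp_all add: offspring_def)
  also have "\<dots> = (\<integral>\<^sup>+\<omega>. \<integral>\<^sup>+z. h (snd z n) \<partial>distr (K q \<omega>) (R q \<Otimes>\<^sub>M N q) (Pair \<omega>) \<partial>R q)"
    unfolding joint_law by (rule nn_integral_bind[OF _ Pair_kernel_measurable]) measurable
  also have "\<dots> = (\<integral>\<^sup>+\<omega>. \<integral>\<^sup>+p. h p \<partial>P (X n \<omega>) \<partial>R q)"
  proof (rule nn_integral_cong)
    fix \<omega> assume w: "\<omega> \<in> space (R q)"
    interpret product_prob_space "\<lambda>n. P (X n \<omega>)" "generation q" by (rule product_prob_space_P)
    have "(\<integral>\<^sup>+z. h (snd z n) \<partial>distr (K q \<omega>) (R q \<Otimes>\<^sub>M N q) (Pair \<omega>)) = (\<integral>\<^sup>+y. h (y n) \<partial>K q \<omega>)"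
      using w by (subst nn_integral_distr) auto
    also have "\<dots> = (\<integral>\<^sup>+p. h p \<partial>distr (K q \<omega>) (P (X n \<omega>)) (\<lambda>y. y n))"
      unfolding K_def using n by (subst nn_integral_distr) auto
    \<comment> \<open>A coordinate of a product of probability measures has the corresponding factor
      as its law.\<close>
    also have "distr (K q \<omega>) (P (X n \<omega>)) (\<lambda>y. y n) = P (X n \<omega>)"
      unfolding K_def by (rule PiM_component[OF n])
    finally show "(\<integral>\<^sup>+z. h (snd z n) \<partial>distr (K q \<omega>) (R q \<Otimes>\<^sub>M N q) (Pair \<omega>)) = (\<integral>\<^sup>+p. h p \<partial>P (X n \<omega>))" .
  qed
  also have "\<dots> = (\<integral>\<^sup>+\<omega>. \<integral>\<^sup>+p. h p \<partial>P (X n \<omega>) \<partial>M)"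
    by (rule nn_integral_subalgebra2[OF subalg], rule measurable_compose[OF X_measurable_Fl[OF n]],
        rule measurable_compose[OF measurable_prob_algebraD[OF P_measurable] nn_integral_measurable_subprob_algebra[OF h]])
  finally show ?thesis .
qed

end

subsection \<open>Law of large numbers for generation averages\<close>

locale bmc_admissible = admissible P \<nu> \<mu> F + bmc P M Fl X \<nu>
  for P :: "'a::metric_space \<Rightarrow> ('a \<times> 'a) measure" and \<nu> \<mu> F
    and M :: "'b measure" and Fl X
begin

text \<open>As for the iterates of Q, the dominating function 1 + u^2 is carried one generation
  back: its integral at a daughter is the integral at the mother of a function in \<open>F\<close>.
  At the root, \<open>F\<close> is integrable with respect to the initial law.\<close>

lemma integrable_X:
  assumes "u \<in> F" "n \<in> generation q"
  shows "integrable M (\<lambda>\<omega>. u (X n \<omega>))"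
  using assms
proof (induction q arbitrary: u n)
  case 0
  then have "n = 1" by (simp add: generation_def)
  have X1: "X 1 \<in> M \<rightarrow>\<^sub>M borel" by (rule X_measurable[of _ 0]) (simp add: generation_def)
  have "distr M borel (X 1) = \<nu>" using chain by (simp add: bifurcating_markov_chain_def)
  then show ?case
    using F_integrable_\<nu>[OF 0(1)] integrable_distr_eq[OF X1 F_measurable[OF 0(1)]] \<open>n = 1\<close> by simp
next
  case (Suc q)
  define w where "w x = 1 + (u x)\<^sup>2" for x
  have w: "w \<in> F" unfolding w_def by (intro F_add F_const F_square Suc.prems)
  note [measurable] = F_measurable[OF w] F_measurable[OF Suc.prems(1)] X_measurable[OF Suc.prems(2)]
  have w0: "0 \<le> w y" for y by (simp add: w_def)
  \<comment> \<open>\<open>m\<close> is the mother of \<open>n\<close>, and the projection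
    \<open>h\<close> below records which daughter \<open>n\<close> is.\<close>
  define m where "m = n div 2"
  have m: "m \<in> generation q" using Suc.prems(2) by (auto simp: m_def generation_def)
  obtain h where h: "h \<in> {fst, snd}" and Xn: "X n = (\<lambda>\<omega>. h (Y m \<omega>))"
  proof (cases "even n")
    case True
    then have "n = 2 * m" by (simp add: m_def)
    then show ?thesis by (intro that[of fst]) (simp_all add: Y_def)
  next
    case False
    then have "n = 2 * m + 1" by (simp add: m_def)
    then show ?thesis by (intro that[of snd]) (simp_all add: Y_def)
  qed
  have [measurable]: "h \<in> borel \<Otimes>\<^sub>M borel \<rightarrow>\<^sub>M borel" using h by auto
  have hint: "integrable (P x) (\<lambda>p. w (h p))" for x
    using h F_integrable_P[OF w] by auto
  \<comment> \<open>A function of one daughter only is a tensor with the constant 1.\<close>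
  have hF: "P2 P (\<lambda>p. w (h p)) \<in> F"
    using h F_tensor[OF w F_const[of 1]] F_tensor[OF F_const[of 1] w]
    by (auto simp: tensor_def case_prod_unfold)
  have hP0: "0 \<le> P2 P (\<lambda>p. w (h p)) x" for x
    unfolding P2_def by (intro Bochner_Integration.integral_nonneg w0)
  have "(\<integral>\<^sup>+\<omega>. ennreal (w (X n \<omega>)) \<partial>M) = (\<integral>\<^sup>+\<omega>. \<integral>\<^sup>+p. ennreal (w (h p)) \<partial>P (X m \<omega>) \<partial>M)"
    unfolding Xn by (rule nn_integral_offspring[OF m]) measurable
  also have "\<dots> = (\<integral>\<^sup>+\<omega>. ennreal (P2 P (\<lambda>p. w (h p)) (X m \<omega>)) \<partial>M)"
    unfolding P2_def by (intro nn_integral_cong nn_integral_eq_integral hint AE_I2 w0)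
  also have "\<dots> = ennreal (\<integral>\<omega>. P2 P (\<lambda>p. w (h p)) (X m \<omega>) \<partial>M)"
    by (intro nn_integral_eq_integral Suc.IH hF m AE_I2 hP0)
  finally have "integrable M (\<lambda>\<omega>. w (X n \<omega>))"
    using w0 by (intro integrableI_nonneg) auto
  then show ?case
    by (rule Bochner_Integration.integrable_bound)
       (use w0 abs_le_1_plus_square in \<open>auto simp: w_def\<close>)
qed

section \<open>Moments of the averages over one generation\<close>

definition gen_avg :: "nat \<Rightarrow> ('a \<Rightarrow> real) \<Rightarrow> 'b \<Rightarrow> real" where
  "gen_avg q u \<omega> = (\<Sum>n\<in>generation q. u (X n \<omega>)) / 2 ^ q"

lemma integrable_gen_avg: "u \<in> F \<Longrightarrow> integrable M (gen_avg q u)"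
  unfolding gen_avg_def[abs_def] by (intro Bochner_Integration.integrable_divide Bochner_Integration.integrable_sum integrable_X)

lemma gen_avg_measurable: "u \<in> F \<Longrightarrow> gen_avg q u \<in> borel_measurable M"
  using integrable_gen_avg by blast

lemma gen_avg_mono: "(\<And>x. u x \<le> w x) \<Longrightarrow> gen_avg q u \<omega> \<le> gen_avg q w \<omega>"
  unfolding gen_avg_def by (intro divide_right_mono sum_mono) auto

text \<open>This is the Cauchy-Schwarz inequality for a sum of \<open>2 ^ q\<close> terms.\<close>

lemma gen_avg_square_le: "(gen_avg q u \<omega>)\<^sup>2 \<le> gen_avg q (\<lambda>x. (u x)\<^sup>2) \<omega>"
proof -
  have "(\<Sum>n\<in>generation q. u (X n \<omega>))\<^sup>2 \<le> (\<Sum>n\<in>generation q. (u (X n \<omega>))\<^sup>2) * 2 ^ q"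
    using sum_squared_le_sum_of_squares[of "\<lambda>n. u (X n \<omega>)" "generation q"] by (simp add: card_generation)
  then show ?thesis
    by (simp add: gen_avg_def power_divide divide_simps power2_eq_square)
qed

lemma integrable_gen_avg_square:
  assumes "u \<in> F" shows "integrable M (\<lambda>\<omega>. (gen_avg q u \<omega>)\<^sup>2)"
proof (rule Bochner_Integration.integrable_bound[OF integrable_gen_avg[OF F_square[OF assms], of q] _ AE_I2])
  show "(\<lambda>\<omega>. (gen_avg q u \<omega>)\<^sup>2) \<in> borel_measurable M"
    by (intro borel_measurable_power gen_avg_measurable assms)
  show "norm ((gen_avg q u \<omega>)\<^sup>2) \<le> norm (gen_avg q (\<lambda>x. (u x)\<^sup>2) \<omega>)" for \<omega>
    using order_trans[OF gen_avg_square_le abs_ge_self] by simp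
qed

definition daughter_sum :: "('a \<Rightarrow> real) \<Rightarrow> 'a \<times> 'a \<Rightarrow> real" where
  "daughter_sum u p = u (fst p) + u (snd p)"

lemma P2_daughter_sum: "u \<in> F \<Longrightarrow> P2 P (daughter_sum u) x = 2 * Q1 u x"
  unfolding P2_def daughter_sum_def Q1_def by (simp add: F_integrable_P)

lemma daughter_sum_integrable: "u \<in> F \<Longrightarrow> integrable (P x) (daughter_sum u)"
  unfolding daughter_sum_def[abs_def] by (intro Bochner_Integration.integrable_add F_integrable_P)

lemma daughter_sum_measurable: "u \<in> F \<Longrightarrow> daughter_sum u \<in> borel_measurable (borel \<Otimes>\<^sub>M borel)"
  using F_measurable[measurable] unfolding daughter_sum_def[abs_def] by measurable

lemma gen_avg_Suc: "gen_avg (Suc q) u \<omega> = (\<Sum>n\<in>generation q. daughter_sum u (Y n \<omega>)) / 2 ^ Suc q"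
  by (simp add: gen_avg_def sum_generation_Suc daughter_sum_def Y_def)

lemma integrable_daughter_sum:
  assumes "u \<in> F" "n \<in> generation q"
  shows "integrable M (\<lambda>\<omega>. daughter_sum u (Y n \<omega>))"
  unfolding daughter_sum_def Y_def fst_conv snd_conv
  by (rule Bochner_Integration.integrable_add[OF
        integrable_X[OF assms(1) daughters_generation(1)[OF assms(2)]]
        integrable_X[OF assms(1) daughters_generation(2)[OF assms(2)]]])

lemma expectation_gen_avg_Suc:
  assumes u: "u \<in> F"
  shows "expectation (gen_avg (Suc q) u) = expectation (gen_avg q (Q1 u))"
proof -
  have "expectation (gen_avg (Suc q) u) = (\<Sum>n\<in>generation q. expectation (\<lambda>\<omega>. daughter_sum u (Y n \<omega>))) / 2 ^ Suc q"
    unfolding gen_avg_Suc[abs_def] by (simp add: integrable_daughter_sum u)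
  also have "(\<Sum>n\<in>generation q. expectation (\<lambda>\<omega>. daughter_sum u (Y n \<omega>))) = (\<Sum>n\<in>generation q. 2 * expectation (\<lambda>\<omega>. Q1 u (X n \<omega>)))"
    using integral_offspring(2)[OF _ daughter_sum_measurable[OF u] daughter_sum_integrable[OF u]
        integrable_daughter_sum[OF u]]
    by (intro sum.cong) (simp_all add: P2_daughter_sum[OF u])
  also have "\<dots> / 2 ^ Suc q = expectation (gen_avg q (Q1 u))"
    unfolding gen_avg_def[abs_def] by (simp add: integrable_X Q1_F u flip: sum_distrib_left)
  finally show ?thesis .
qed

lemma expectation_gen_avg: "u \<in> F \<Longrightarrow> expectation (gen_avg q u) = expectation (\<lambda>\<omega>. (Q1 ^^ q) u (X 1 \<omega>))"
proof (induction q arbitrary: u)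
  case 0
  then show ?case by (simp add: gen_avg_def[abs_def] generation_0)
next
  case (Suc q)
  then show ?case by (simp add: expectation_gen_avg_Suc Q1_F funpow_swap1)
qed

text \<open>The expectation at generation q is that of the q-th power of \<open>Q1\<close> at the
  root, and a single function of \<open>F\<close> dominates all these powers.\<close>

lemma expectation_gen_avg_bounded:
  assumes u: "u \<in> F"
  obtains C where "\<And>q. expectation (gen_avg q u) \<le> C"
proof -
  obtain w where w: "w \<in> F" "\<And>r x. \<bar>(Q1 ^^ r) u x\<bar> \<le> w x" using Q1_funpow_bound[OF u] by blast
  have 1: "1 \<in> generation 0" by (simp add: generation_def)
  have "expectation (gen_avg q u) \<le> expectation (\<lambda>\<omega>. w (X 1 \<omega>))" for q
    unfolding expectation_gen_avg[OF u]
    using w(2) by (intro integral_mono integrable_X[OF _ 1] Q1_funpow_F u w(1)) (auto intro: abs_le_D1)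
  then show thesis by (rule that)
qed

text \<open>Daughters of distinct mothers are conditionally independent, so only the \<open>2\<^sup>q\<close> diagonal terms
  obstruct equality.\<close>

lemma second_moment_Suc:
  assumes u: "u \<in> F"
  shows "expectation (\<lambda>\<omega>. (gen_avg (Suc q) u \<omega>)\<^sup>2) \<le>
    expectation (\<lambda>\<omega>. (gen_avg q (Q1 u) \<omega>)\<^sup>2) + expectation (gen_avg (Suc q) (\<lambda>x. (u x)\<^sup>2)) / 2 ^ q"
proof -
  define U where "U n \<omega> = daughter_sum u (Y n \<omega>)" for n \<omega>
  define W where "W n \<omega> = Q1 u (X n \<omega>)" for n \<omega>
  define s where "s = (\<lambda>x. (u x)\<^sup>2)"
  have sF: "s \<in> F" unfolding s_def by (rule F_square[OF u])
  have U2: "(U n \<omega>)\<^sup>2 \<le> 2 * daughter_sum s (Y n \<omega>)" for n \<omega>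
    using sum_squares_bound[of "u (fst (Y n \<omega>))" "u (snd (Y n \<omega>))"]
    by (simp add: U_def daughter_sum_def s_def power2_sum)
  have Um: "U n \<in> borel_measurable M" if "n \<in> generation q" for n
    unfolding U_def[abs_def] by (rule measurable_compose[OF Y_measurable[OF that] daughter_sum_measurable[OF u]])
  have iU2: "integrable M (\<lambda>\<omega>. (U n \<omega>)\<^sup>2)" if n: "n \<in> generation q" for n
    by (rule Bochner_Integration.integrable_bound[OF integrable_mult_right[OF integrable_daughter_sum[OF sF n], of 2]])
       (use Um[OF n] U2 in \<open>auto intro: order_trans[OF _ abs_ge_self]\<close>)
  have iUU: "integrable M (\<lambda>\<omega>. U i \<omega> * U j \<omega>)" if "i \<in> generation q" "j \<in> generation q" for i j
    by (rule Bochner_Integration.integrable_bound[OF Bochner_Integration.integrable_add[OF iU2[OF that(1)] iU2[OF that(2)]]])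
       (use Um that abs_mult_le_squares in auto)
  have iW2: "integrable M (\<lambda>\<omega>. (W n \<omega>)\<^sup>2)" if "n \<in> generation q" for n
    unfolding W_def by (rule integrable_X[OF F_square[OF Q1_F[OF u]] that])
  have Wm: "W n \<in> borel_measurable M" if "n \<in> generation q" for n
    unfolding W_def[abs_def] by (rule measurable_compose[OF X_measurable[OF that] F_measurable[OF Q1_F[OF u]]])
  have iWW: "integrable M (\<lambda>\<omega>. W i \<omega> * W j \<omega>)" if "i \<in> generation q" "j \<in> generation q" for i j
    by (rule Bochner_Integration.integrable_bound[OF Bochner_Integration.integrable_add[OF iW2[OF that(1)] iW2[OF that(2)]]])
       (use Wm that abs_mult_le_squares in auto)
  \<comment> \<open>The factor 4 stems from the two factors 2 in \<open>P2_daughter_sum\<close>. On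
    the diagonal the nonnegative \<open>W\<close> term is added so that the double sum closes up to
    a full square.\<close>
  have cross: "expectation (\<lambda>\<omega>. U i \<omega> * U j \<omega>) \<le>
      4 * expectation (\<lambda>\<omega>. W i \<omega> * W j \<omega>) + (if i = j then 2 * expectation (\<lambda>\<omega>. daughter_sum s (Y i \<omega>)) else 0)"
    if ij: "i \<in> generation q" "j \<in> generation q" for i j
  proof (cases "i = j")
    case True
    have "expectation (\<lambda>\<omega>. U i \<omega> * U i \<omega>) \<le> expectation (\<lambda>\<omega>. 2 * daughter_sum s (Y i \<omega>))"
      using U2 by (intro integral_mono iUU[OF ij(1) ij(1)] integrable_mult_right integrable_daughter_sum[OF sF ij(1)]) (auto simp: power2_eq_square)
    also have "\<dots> = 2 * expectation (\<lambda>\<omega>. daughter_sum s (Y i \<omega>))" by (rule integral_mult_right_zero)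
    finally have "expectation (\<lambda>\<omega>. U i \<omega> * U i \<omega>) \<le> 2 * expectation (\<lambda>\<omega>. daughter_sum s (Y i \<omega>))" .
    moreover have "0 \<le> expectation (\<lambda>\<omega>. W i \<omega> * W i \<omega>)" by (intro Bochner_Integration.integral_nonneg) auto
    ultimately have "expectation (\<lambda>\<omega>. U i \<omega> * U i \<omega>) \<le>
        4 * expectation (\<lambda>\<omega>. W i \<omega> * W i \<omega>) + 2 * expectation (\<lambda>\<omega>. daughter_sum s (Y i \<omega>))" by linarith
    then show ?thesis unfolding True[symmetric] if_P[OF refl] .
  next
    case False
    have "expectation (\<lambda>\<omega>. U i \<omega> * U j \<omega>) = expectation (\<lambda>\<omega>. (2 * W i \<omega>) * (2 * W j \<omega>))"
      using integral_offspring_mult(2)[OF ij False daughter_sum_measurable[OF u] daughter_sum_integrable[OF u]] iUU[OF ij]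
      by (simp add: U_def W_def P2_daughter_sum[OF u])
    also have "\<dots> = 4 * expectation (\<lambda>\<omega>. W i \<omega> * W j \<omega>)"
      by (subst integral_mult_right_zero[symmetric]) (simp add: mult_ac)
    finally show ?thesis using False by simp
  qed
  have "expectation (\<lambda>\<omega>. (\<Sum>n\<in>generation q. U n \<omega>)\<^sup>2) =
      (\<Sum>i\<in>generation q. \<Sum>j\<in>generation q. expectation (\<lambda>\<omega>. U i \<omega> * U j \<omega>))"
    by (simp add: power2_eq_square sum_product iUU)
  also have "\<dots> \<le> (\<Sum>i\<in>generation q. \<Sum>j\<in>generation q. 4 * expectation (\<lambda>\<omega>. W i \<omega> * W j \<omega>)
      + (if i = j then 2 * expectation (\<lambda>\<omega>. daughter_sum s (Y i \<omega>)) else 0))"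
    by (intro sum_mono cross)
  also have "\<dots> = 4 * (\<Sum>i\<in>generation q. \<Sum>j\<in>generation q. expectation (\<lambda>\<omega>. W i \<omega> * W j \<omega>)) +
      2 * (\<Sum>i\<in>generation q. expectation (\<lambda>\<omega>. daughter_sum s (Y i \<omega>)))"
    by (simp add: sum.distrib sum_distrib_left)
  also have "(\<Sum>i\<in>generation q. \<Sum>j\<in>generation q. expectation (\<lambda>\<omega>. W i \<omega> * W j \<omega>)) =
      expectation (\<lambda>\<omega>. (\<Sum>n\<in>generation q. W n \<omega>)\<^sup>2)"
    by (simp add: power2_eq_square sum_product iWW)
  also have "(\<Sum>i\<in>generation q. expectation (\<lambda>\<omega>. daughter_sum s (Y i \<omega>))) = 2 ^ Suc q * expectation (gen_avg (Suc q) s)"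
    unfolding gen_avg_Suc[abs_def] by (simp add: integrable_daughter_sum sF)
  finally have main: "expectation (\<lambda>\<omega>. (\<Sum>n\<in>generation q. U n \<omega>)\<^sup>2) \<le>
      4 * expectation (\<lambda>\<omega>. (\<Sum>n\<in>generation q. W n \<omega>)\<^sup>2) + 2 * (2 ^ Suc q * expectation (gen_avg (Suc q) s))" .
  have L: "expectation (\<lambda>\<omega>. (gen_avg (Suc q) u \<omega>)\<^sup>2) = expectation (\<lambda>\<omega>. (\<Sum>n\<in>generation q. U n \<omega>)\<^sup>2) / (2 ^ Suc q)\<^sup>2"
    by (simp add: gen_avg_Suc U_def power_divide)
  have Rr: "expectation (\<lambda>\<omega>. (gen_avg q (Q1 u) \<omega>)\<^sup>2) = expectation (\<lambda>\<omega>. (\<Sum>n\<in>generation q. W n \<omega>)\<^sup>2) / (2 ^ q)\<^sup>2"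
    by (simp add: gen_avg_def W_def power_divide)
  \<comment> \<open>Division by 4 * 4^q cancels the factor 4 and leaves 2^(-q) in front of the
    diagonal contribution.\<close>
  have "expectation (\<lambda>\<omega>. (gen_avg (Suc q) u \<omega>)\<^sup>2) \<le>
    (4 * expectation (\<lambda>\<omega>. (\<Sum>n\<in>generation q. W n \<omega>)\<^sup>2) + 2 * (2 ^ Suc q * expectation (gen_avg (Suc q) s))) / (2 ^ Suc q)\<^sup>2"
    unfolding L by (intro divide_right_mono main) simp
  also have "\<dots> = expectation (\<lambda>\<omega>. (gen_avg q (Q1 u) \<omega>)\<^sup>2) + expectation (gen_avg (Suc q) s) / 2 ^ q"
    unfolding Rr by (simp add: field_simps power2_eq_square)
  finally show ?thesis unfolding s_def .
qed

text \<open>The second moment of \<open>u\<close> at a late generation is compared with that of a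
  high power of \<open>Q1\<close> at a fixed generation \<open>k\<close>. The cost is a geometric
  tail that is small for large \<open>k\<close>, and at fixed \<open>k\<close> the powers tend to
  the mean 0.\<close>

lemma second_moment_tendsto_0:
  assumes u: "u \<in> F" and mean: "(\<integral>x. u x \<partial>\<mu>) = 0"
  shows "(\<lambda>q. expectation (\<lambda>\<omega>. (gen_avg q u \<omega>)\<^sup>2)) \<longlonglongrightarrow> 0"
proof -
  define a where "a q m = expectation (\<lambda>\<omega>. (gen_avg q ((Q1 ^^ m) u) \<omega>)\<^sup>2)" for q m
  \<comment> \<open>\<open>b\<close> has two uses: it controls the diagonal error of
    \<open>second_moment_Suc\<close> uniformly, and it dominates \<open>a\<close> when the power of
    \<open>Q1\<close> grows.\<close>
  define b where "b q m = expectation (gen_avg q (\<lambda>x. ((Q1 ^^ m) u x)\<^sup>2))" for q m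
  note uF = Q1_funpow_F[OF u]
  obtain w where w: "w \<in> F" "\<And>r x. \<bar>(Q1 ^^ r) u x\<bar> \<le> w x" using Q1_funpow_bound[OF u] by blast
  have sq: "((Q1 ^^ m) u x)\<^sup>2 \<le> (w x)\<^sup>2" for m x
  proof -
    have "\<bar>(Q1 ^^ m) u x\<bar> \<le> \<bar>w x\<bar>" by (rule order_trans[OF w(2) abs_ge_self])
    then show ?thesis by (simp only: abs_le_square_iff)
  qed
  obtain C where C: "\<And>q. expectation (gen_avg q (\<lambda>x. (w x)\<^sup>2)) \<le> C"
    using expectation_gen_avg_bounded[OF F_square[OF w(1)]] by blast
  have bC: "b q m \<le> C" for q m
    unfolding b_def
    by (rule order_trans[OF integral_mono C], intro integrable_gen_avg F_square uF,
        intro integrable_gen_avg F_square w(1), rule gen_avg_mono[OF sq])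
  \<comment> \<open>With \<open>q\<close> fixed the average has finitely many terms, each tending to
    0 pointwise; the square of the common bound \<open>w\<close> is an integrable majorant.\<close>
  have b0: "(\<lambda>m. b q m) \<longlonglongrightarrow> 0" for q
  proof -
    have "(\<lambda>m. expectation (gen_avg q (\<lambda>x. ((Q1 ^^ m) u x)\<^sup>2))) \<longlonglongrightarrow> expectation (\<lambda>\<omega>. 0)"
    proof (rule integral_dominated_convergence[where w="gen_avg q (\<lambda>x. (w x)\<^sup>2)"])
      show "AE \<omega> in M. (\<lambda>m. gen_avg q (\<lambda>x. ((Q1 ^^ m) u x)\<^sup>2) \<omega>) \<longlonglongrightarrow> 0"
      proof (rule AE_I2)
        fix \<omega>
        have "(\<lambda>m. (\<Sum>n\<in>generation q. ((Q1 ^^ m) u (X n \<omega>))\<^sup>2) / 2 ^ q) \<longlonglongrightarrow> (\<Sum>n\<in>generation q. 0\<^sup>2) / 2 ^ q"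
          using Q1_funpow_tendsto[OF u] unfolding mean by (intro tendsto_intros) auto
        then show "(\<lambda>m. gen_avg q (\<lambda>x. ((Q1 ^^ m) u x)\<^sup>2) \<omega>) \<longlonglongrightarrow> 0" by (simp add: gen_avg_def)
      qed
      show "AE \<omega> in M. norm (gen_avg q (\<lambda>x. ((Q1 ^^ m) u x)\<^sup>2) \<omega>) \<le> gen_avg q (\<lambda>x. (w x)\<^sup>2) \<omega>" for m
      proof (rule AE_I2)
        fix \<omega>
        have "0 \<le> gen_avg q (\<lambda>x. ((Q1 ^^ m) u x)\<^sup>2) \<omega>" by (simp add: gen_avg_def sum_nonneg)
        then show "norm (gen_avg q (\<lambda>x. ((Q1 ^^ m) u x)\<^sup>2) \<omega>) \<le> gen_avg q (\<lambda>x. (w x)\<^sup>2) \<omega>"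
          using gen_avg_mono[of "\<lambda>x. ((Q1 ^^ m) u x)\<^sup>2", OF sq] by simp
      qed
    qed (auto intro!: gen_avg_measurable integrable_gen_avg F_square uF w(1))
    then show ?thesis by (simp add: b_def)
  qed
  have ab: "a q m \<le> b q m" for q m
    unfolding a_def b_def
    by (intro integral_mono integrable_gen_avg_square integrable_gen_avg F_square uF gen_avg_square_le)
  have a_nonneg: "0 \<le> a q m" for q m unfolding a_def by (intro Bochner_Integration.integral_nonneg) simp
  have a0: "(\<lambda>m. a q m) \<longlonglongrightarrow> 0" for q
    by (rule tendsto_sandwich[OF _ _ tendsto_const b0[of q]];
        intro always_eventually allI a_nonneg ab)
  have step: "a (Suc q) m \<le> a q (Suc m) + C / 2 ^ q" for q m
    using second_moment_Suc[OF uF, of q m] divide_right_mono[OF bC[of "Suc q" m], of "2 ^ q"]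
    by (simp add: a_def b_def)
  txt \<open>Iterating the recursion down to a fixed generation \<open>k\<close> costs only a geometric tail.\<close>
  have iter: "a (k + j) m \<le> a k (m + j) + 2 * C / 2 ^ k - 2 * C / 2 ^ (k + j)" for k j m
  proof (induction j arbitrary: m)
    case (Suc j)
    have "a (k + Suc j) m \<le> a (k + j) (Suc m) + C / 2 ^ (k + j)" using step[of "k + j" m] by simp
    also have "\<dots> \<le> a k (Suc m + j) + 2 * C / 2 ^ k - 2 * C / 2 ^ (k + j) + C / 2 ^ (k + j)"
      using Suc[of "Suc m"] by simp
    finally have "a (k + Suc j) m \<le> a k (Suc m + j) + 2 * C / 2 ^ k - 2 * C / 2 ^ (k + j) + C / 2 ^ (k + j)" .
    moreover have "2 * C / 2 ^ (k + Suc j) = C / 2 ^ (k + j)" by simp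
    ultimately show ?case by simp
  qed simp
  have C0: "0 \<le> C" using order_trans[OF order_trans[OF a_nonneg ab] bC] .
  have "(\<lambda>q. a q 0) \<longlonglongrightarrow> 0"
  proof (rule LIMSEQ_I)
    fix e :: real assume "0 < e"
    then have e: "0 < e / 2" by simp
    \<comment> \<open>First \<open>k\<close> is chosen to make the tail small, then
      \<open>j0\<close> depending on that \<open>k\<close>.\<close>
    have "(\<lambda>k. 2 * C / 2 ^ k) \<longlonglongrightarrow> 0" by (rule LIMSEQ_divide_realpow_zero) simp
    from LIMSEQ_D[OF this e] obtain k where "norm (2 * C / 2 ^ k - 0) < e / 2" by blast
    then have k: "2 * C / 2 ^ k < e / 2" unfolding real_norm_def by linarith
    from LIMSEQ_D[OF a0[of k] e] obtain j0 where "\<forall>j\<ge>j0. norm (a k j - 0) < e / 2" by blast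
    then have j0: "a k j < e / 2" if "j0 \<le> j" for j
      using that unfolding real_norm_def by (metis abs_ge_self diff_zero le_less_trans)
    have "norm (a q 0 - 0) < e" if "k + j0 \<le> q" for q
    proof -
      define j where "j = q - k"
      have j: "q = k + j" "j0 \<le> j" using that by (simp_all add: j_def)
      have "0 \<le> 2 * C / 2 ^ (k + j)" using C0 by simp
      then have "a q 0 \<le> a k j + 2 * C / 2 ^ k" using iter[of k j 0] unfolding j(1) by simp
      with j0[OF j(2)] k have "a q 0 < e" by linarith
      then show ?thesis using a_nonneg[of q 0] by simp
    qed
    then show "\<exists>q0. \<forall>q\<ge>q0. norm (a q 0 - 0) < e" by blast
  qed
  then show ?thesis by (simp add: a_def)
qed

text \<open>Subtracting the limit keeps the function in \<open>F\<close> and makes it centred under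
  the limit law, so the second moment result applies.\<close>

lemma gen_avg_L1_tendsto:
  assumes u: "u \<in> F"
  shows "(\<lambda>q. expectation (\<lambda>\<omega>. \<bar>gen_avg q u \<omega> - (\<integral>x. u x \<partial>\<mu>)\<bar>)) \<longlonglongrightarrow> 0"
proof -
  define c where "c = (\<integral>x. u x \<partial>\<mu>)"
  define h where "h x = u x - c" for x
  interpret \<mu>: prob_space \<mu> by (rule prob_space_\<mu>)
  have hF: "h \<in> F" unfolding h_def by (intro F_diff u F_const)
  have h0: "(\<integral>x. h x \<partial>\<mu>) = 0"
    unfolding h_def by (simp add: F_integrable_\<mu>[OF u] \<mu>.prob_space c_def)
  have eq: "gen_avg q h \<omega> = gen_avg q u \<omega> - c" for q \<omega>
    by (simp add: gen_avg_def h_def sum_subtractf card_generation diff_divide_distrib)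
  have "(\<lambda>q. sqrt (expectation (\<lambda>\<omega>. (gen_avg q h \<omega>)\<^sup>2))) \<longlonglongrightarrow> sqrt 0"
    by (intro tendsto_real_sqrt second_moment_tendsto_0 hF h0)
  then have lim: "(\<lambda>q. sqrt (expectation (\<lambda>\<omega>. (gen_avg q h \<omega>)\<^sup>2))) \<longlonglongrightarrow> 0" by simp
  have "(\<lambda>q. expectation (\<lambda>\<omega>. \<bar>gen_avg q h \<omega>\<bar>)) \<longlonglongrightarrow> 0"
    by (rule tendsto_sandwich[OF _ _ tendsto_const lim])
       (auto intro!: always_eventually Bochner_Integration.integral_nonneg expectation_abs_le_sqrt
          gen_avg_measurable integrable_gen_avg_square hF)
  then show ?thesis by (simp add: eq c_def)
qed

end

subsection \<open>The central limit theorem\<close>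

locale bmc_functional = bmc_admissible P \<nu> \<mu> F M Fl X
  for P :: "'a::metric_space \<Rightarrow> ('a \<times> 'a) measure" and \<nu> \<mu> F
    and M :: "'b measure" and Fl X +
  fixes f :: "'a \<times> 'a \<times> 'a \<Rightarrow> real"
  assumes f_measurable [measurable]: "f \<in> borel_measurable (borel \<Otimes>\<^sub>M (borel \<Otimes>\<^sub>M borel))"
    and f1: "P3_exists P f" "P3 P f \<in> F"
    and f2: "P3_exists P (\<lambda>t. (f t) ^ 2)" "P3 P (\<lambda>t. (f t) ^ 2) \<in> F"
    and f4: "P3_exists P (\<lambda>t. (f t) ^ 4)" "P3 P (\<lambda>t. (f t) ^ 4) \<in> F"
begin

section \<open>Conditional moments and conditional characteristic function of the centred
  functional\<close>

definition g :: "'a \<times> 'a \<times> 'a \<Rightarrow> real" where "g t = f t - P3 P f (fst t)"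
definition v :: "'a \<Rightarrow> real" where "v x = P3 P (\<lambda>t. (f t) ^ 2) x - (P3 P f x)\<^sup>2"
text \<open>A bound for the conditional fourth moment of \<open>g\<close>, from (a - c)^4 \<le>
  8(a^4 + c^4). The iterated square matches the closure of \<open>F\<close> under squares.\<close>

definition k :: "'a \<Rightarrow> real" where "k x = 8 * (P3 P (\<lambda>t. (f t) ^ 4) x + ((P3 P f x)\<^sup>2)\<^sup>2)"
text \<open>It collects the coefficients of the expansion error in \<open>cf_approx\<close>: the
  second and fourth moments bound the cubic Taylor remainder, and the square of \<open>v\<close>
  comes from expanding the exponential.\<close>

definition w :: "'a \<Rightarrow> real" where "w x = v x + k x + (v x)\<^sup>2"
definition s2 :: real where "s2 = (\<integral>x. v x \<partial>\<mu>)"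
definition cf :: "real \<Rightarrow> 'a \<Rightarrow> complex" where "cf \<theta> x = (\<integral>p. iexp (\<theta> * g (x, p)) \<partial>P x)"

lemma g_measurable [measurable]: "g \<in> borel_measurable (borel \<Otimes>\<^sub>M (borel \<Otimes>\<^sub>M borel))"
  using F_measurable[OF f1(2), measurable] unfolding g_def[abs_def] by measurable

lemma v_F: "v \<in> F" and k_F: "k \<in> F" and w_F: "w \<in> F"
proof -
  show v: "v \<in> F" unfolding v_def[abs_def] by (intro F_diff F_square f1 f2)
  show k: "k \<in> F" unfolding k_def[abs_def] by (intro F_scale F_add F_square f1 f4)
  show "w \<in> F" unfolding w_def[abs_def] by (intro F_add F_square v k)
qed

lemma g_moments:
  shows g_integrable: "integrable (P x) (\<lambda>p. g (x, p))"
    and g2_integrable: "integrable (P x) (\<lambda>p. (g (x, p))\<^sup>2)"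
    and g4_integrable: "integrable (P x) (\<lambda>p. g (x, p) ^ 4)"
    and g_mean: "(\<integral>p. g (x, p) \<partial>P x) = 0"
    and g2_mean: "(\<integral>p. (g (x, p))\<^sup>2 \<partial>P x) = v x"
    and g4_mean: "(\<integral>p. g (x, p) ^ 4 \<partial>P x) \<le> k x"
proof -
  interpret P: prob_space "P x" by (rule prob_space_P)
  define c where "c = P3 P f x"
  have g: "g (x, p) = f (x, p) - c" for p by (simp add: g_def c_def)
  have i1: "integrable (P x) (\<lambda>p. f (x, p))" and i2: "integrable (P x) (\<lambda>p. (f (x, p))\<^sup>2)"
    and i4: "integrable (P x) (\<lambda>p. f (x, p) ^ 4)"
    using f1 f2 f4 by (simp_all add: P3_exists_def)
  have c: "(\<integral>p. f (x, p) \<partial>P x) = c" by (simp add: c_def P3_def)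
  show "integrable (P x) (\<lambda>p. g (x, p))" unfolding g using i1 by simp
  show "(\<integral>p. g (x, p) \<partial>P x) = 0" unfolding g using i1 by (simp add: c)
  have sq: "(g (x, p))\<^sup>2 = (f (x, p))\<^sup>2 - 2 * c * f (x, p) + c\<^sup>2" for p
    unfolding g by (simp add: power2_diff)
  show "integrable (P x) (\<lambda>p. (g (x, p))\<^sup>2)" unfolding sq using i1 i2 by simp
  show "(\<integral>p. (g (x, p))\<^sup>2 \<partial>P x) = v x"
    unfolding sq using i1 i2
    by (simp add: c v_def P3_def power2_eq_square) 
  \<comment> \<open>The inequality (a + b)^2 \<le> 2(a^2 + b^2), in its two sign versions, is used
    twice; this yields the constant 8.\<close>
  have b: "g (x, p) ^ 4 \<le> 8 * (f (x, p) ^ 4 + (c\<^sup>2)\<^sup>2)" for p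
  proof -
    have sq2: "(a - b)\<^sup>2 \<le> 2 * (a\<^sup>2 + b\<^sup>2)" "(a + b)\<^sup>2 \<le> 2 * (a\<^sup>2 + b\<^sup>2)" for a b :: real
      using sum_squares_bound[of a b] sum_squares_bound[of a "- b"]
      by (simp_all add: power2_diff power2_sum)
    have "((f (x, p) - c)\<^sup>2)\<^sup>2 \<le> (2 * ((f (x, p))\<^sup>2 + c\<^sup>2))\<^sup>2"
      by (intro power_mono sq2) simp
    also have "\<dots> \<le> 4 * (2 * (((f (x, p))\<^sup>2)\<^sup>2 + (c\<^sup>2)\<^sup>2))"
      unfolding power_mult_distrib using sq2(2)[of "(f (x, p))\<^sup>2" "c\<^sup>2"] by simp
    finally show ?thesis unfolding g by (simp flip: power_mult)
  qed
  have ib: "integrable (P x) (\<lambda>p. 8 * (f (x, p) ^ 4 + (c\<^sup>2)\<^sup>2))" using i4 by simp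
  show i: "integrable (P x) (\<lambda>p. g (x, p) ^ 4)"
  proof (rule Bochner_Integration.integrable_bound[OF ib _ AE_I2])
    show "norm (g (x, p) ^ 4) \<le> norm (8 * (f (x, p) ^ 4 + (c\<^sup>2)\<^sup>2))" for p
      unfolding real_norm_def by (rule order_trans[OF _ abs_ge_self]) (use b[of p] in simp)
  qed measurable
  have "(\<integral>p. g (x, p) ^ 4 \<partial>P x) \<le> (\<integral>p. 8 * (f (x, p) ^ 4 + (c\<^sup>2)\<^sup>2) \<partial>P x)"
    by (rule integral_mono[OF i ib b])
  also have "\<dots> = k x" using i4 by (simp add: k_def P3_def c)
  finally show "(\<integral>p. g (x, p) ^ 4 \<partial>P x) \<le> k x" .
qed

lemma v_nonneg: "0 \<le> v x"
  unfolding g2_mean[symmetric] by (intro Bochner_Integration.integral_nonneg) simp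

lemma k_nonneg: "0 \<le> k x"
  by (rule order_trans[OF _ g4_mean]) (simp add: Bochner_Integration.integral_nonneg)

lemma s2_nonneg: "0 \<le> s2"
  unfolding s2_def by (intro Bochner_Integration.integral_nonneg v_nonneg)

lemma s2_eq: "s2 = (\<integral>x. P3 P (\<lambda>t. (f t) ^ 2) x \<partial>\<mu>) - (\<integral>x. (P3 P f x) ^ 2 \<partial>\<mu>)"
  unfolding s2_def v_def
  by (intro Bochner_Integration.integral_diff F_integrable_\<mu> F_square f1 f2)

lemma iexp_g_integrable: "integrable (P x) (\<lambda>p. iexp (\<theta> * g (x, p)))"
proof -
  interpret P: prob_space "P x" by (rule prob_space_P)
  show ?thesis by (intro P.integrable_const_bound[where B=1]) auto
qed

lemma cf_norm_le_1: "cmod (cf \<theta> x) \<le> 1"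
proof -
  interpret P: prob_space "P x" by (rule prob_space_P)
  have "cmod (cf \<theta> x) \<le> (\<integral>p. cmod (iexp (\<theta> * g (x, p))) \<partial>P x)"
    unfolding cf_def by (rule integral_norm_bound)
  then show ?thesis by simp
qed

text \<open>In the second order expansion the linear term has mean zero and the quadratic one gives
  \<open>v\<close>. The cubic remainder is integrated with the help of second and fourth moments;
  then 1 - \<theta>^2 v / 2 is exchanged for an exponential at a cost of order \<theta>^4.\<close>

lemma cf_approx: "cmod (cf \<theta> x - exp (- (\<theta>\<^sup>2 * v x / 2))) \<le> (\<bar>\<theta>\<bar> ^ 3 + \<theta> ^ 4) * w x"
proof -
  interpret P: prob_space "P x" by (rule prob_space_P)
  let ?y = "\<lambda>p. \<theta> * g (x, p)"
  let ?t = "\<lambda>p. complex_of_real (1 - (?y p)\<^sup>2 / 2) + \<i> * complex_of_real (?y p)"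
  have q: "1 - (?y p)\<^sup>2 / 2 = 1 - \<theta>\<^sup>2 / 2 * (g (x, p))\<^sup>2" for p
    by (simp add: power_mult_distrib)
  have ire: "integrable (P x) (\<lambda>p. 1 - (?y p)\<^sup>2 / 2)"
    unfolding q using g2_integrable[of x] by simp
  have iim: "integrable (P x) (\<lambda>p. ?y p)" using g_integrable[of x] by simp
  have re: "(\<integral>p. 1 - (?y p)\<^sup>2 / 2 \<partial>P x) = 1 - \<theta>\<^sup>2 * v x / 2"
    unfolding q using g2_integrable[of x] by (simp add: g2_mean)
  have im: "(\<integral>p. ?y p \<partial>P x) = 0" by (simp add: g_mean)
  have it: "integrable (P x) ?t"
    by (intro Bochner_Integration.integrable_add integrable_mult_right integrable_of_real ire iim)
  have "(\<integral>p. ?t p \<partial>P x) =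
      (\<integral>p. complex_of_real (1 - (?y p)\<^sup>2 / 2) \<partial>P x) + (\<integral>p. \<i> * complex_of_real (?y p) \<partial>P x)"
    by (intro Bochner_Integration.integral_add integrable_mult_right integrable_of_real ire iim)
  also have "\<dots> = complex_of_real (\<integral>p. 1 - (?y p)\<^sup>2 / 2 \<partial>P x) + \<i> * complex_of_real (\<integral>p. ?y p \<partial>P x)"
    by (simp only: integral_complex_of_real integral_mult_right_zero)
  finally have t_int: "(\<integral>p. ?t p \<partial>P x) = complex_of_real (1 - \<theta>\<^sup>2 * v x / 2)"
    unfolding re im by simp
  \<comment> \<open>The third power is the product of the absolute value and its square, bounded by
    the sum of their squares.\<close>
  have cube: "\<bar>g (x, p)\<bar> ^ 3 \<le> (g (x, p))\<^sup>2 + g (x, p) ^ 4" for p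
  proof -
    have "2 * \<bar>g (x, p)\<bar> * \<bar>g (x, p)\<bar>\<^sup>2 \<le> \<bar>g (x, p)\<bar>\<^sup>2 + (\<bar>g (x, p)\<bar>\<^sup>2)\<^sup>2"
      by (rule sum_squares_bound)
    moreover have "0 \<le> \<bar>g (x, p)\<bar> * \<bar>g (x, p)\<bar>\<^sup>2" by simp
    ultimately have "\<bar>g (x, p)\<bar> * \<bar>g (x, p)\<bar>\<^sup>2 \<le> \<bar>g (x, p)\<bar>\<^sup>2 + (\<bar>g (x, p)\<bar>\<^sup>2)\<^sup>2" by linarith
    then show ?thesis by (simp add: power3_eq_cube power4_eq_xxxx power2_eq_square mult_ac)
  qed
  have pt: "cmod (iexp (?y p) - ?t p) \<le> \<bar>\<theta>\<bar> ^ 3 * ((g (x, p))\<^sup>2 + g (x, p) ^ 4)" for p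
  proof -
    have "cmod (iexp (?y p) - ?t p) \<le> \<bar>?y p\<bar> ^ 3"
      by (rule iexp_approx_quadratic)
    also have "\<dots> = \<bar>\<theta>\<bar> ^ 3 * \<bar>g (x, p)\<bar> ^ 3" by (simp add: abs_mult power_mult_distrib)
    also have "\<dots> \<le> \<bar>\<theta>\<bar> ^ 3 * ((g (x, p))\<^sup>2 + g (x, p) ^ 4)" by (intro mult_left_mono cube) simp
    finally show ?thesis .
  qed
  have "cf \<theta> x - complex_of_real (1 - \<theta>\<^sup>2 * v x / 2) = (\<integral>p. iexp (?y p) - ?t p \<partial>P x)"
    unfolding cf_def t_int[symmetric] by (rule Bochner_Integration.integral_diff[OF iexp_g_integrable it, symmetric])
  also have "cmod \<dots> \<le> (\<integral>p. \<bar>\<theta>\<bar> ^ 3 * ((g (x, p))\<^sup>2 + g (x, p) ^ 4) \<partial>P x)"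
    by (rule norm_integral_le)
       (intro Bochner_Integration.integrable_diff Bochner_Integration.integrable_add integrable_mult_right
         it iexp_g_integrable g2_integrable g4_integrable pt)+
  also have "\<dots> = \<bar>\<theta>\<bar> ^ 3 * (v x + (\<integral>p. g (x, p) ^ 4 \<partial>P x))"
    by (simp add: g2_integrable g4_integrable g2_mean)
  also have "\<dots> \<le> \<bar>\<theta>\<bar> ^ 3 * (v x + k x)" by (intro mult_left_mono add_left_mono g4_mean) simp
  finally have 1: "cmod (cf \<theta> x - complex_of_real (1 - \<theta>\<^sup>2 * v x / 2)) \<le> \<bar>\<theta>\<bar> ^ 3 * (v x + k x)" .
  have "\<bar>exp (- (\<theta>\<^sup>2 * v x / 2)) - (1 - \<theta>\<^sup>2 * v x / 2)\<bar> \<le> (\<theta>\<^sup>2 * v x / 2)\<^sup>2"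
    by (rule exp_minus_approx) (simp add: v_nonneg)
  also have "\<dots> \<le> \<theta> ^ 4 * (v x)\<^sup>2"
    by (simp add: power_mult_distrib power_divide divide_simps flip: power_mult)
  finally have 2: "cmod (complex_of_real (1 - \<theta>\<^sup>2 * v x / 2) - exp (- (\<theta>\<^sup>2 * v x / 2))) \<le> \<theta> ^ 4 * (v x)\<^sup>2"
    unfolding of_real_diff[symmetric] norm_of_real by (simp add: abs_minus_commute)
  have "cmod (cf \<theta> x - exp (- (\<theta>\<^sup>2 * v x / 2))) \<le> \<bar>\<theta>\<bar> ^ 3 * (v x + k x) + \<theta> ^ 4 * (v x)\<^sup>2"
    using norm_triangle_mono[OF 1 2] by simp
  also have "\<dots> \<le> (\<bar>\<theta>\<bar> ^ 3 + \<theta> ^ 4) * w x"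
    unfolding w_def distrib_right distrib_left
    by (simp add: v_nonneg k_nonneg)
  finally show ?thesis .
qed

section \<open>The characteristic function, one generation at a time\<close>

definition D :: "nat \<Rightarrow> 'b \<Rightarrow> real" where
  "D q \<omega> = (\<Sum>n\<in>generation q. g (X n \<omega>, Y n \<omega>))"

lemma D_measurable_Fl: "D q \<in> borel_measurable (Fl (Suc q))"
  unfolding D_def[abs_def]
  by (intro borel_measurable_sum measurable_compose[OF measurable_Pair g_measurable] Y_measurable_Fl
      measurable_Fl_mono[OF X_measurable_Fl]) auto

text \<open>Only mothers of generations below \<open>q\<close> enter. Their daughters reach up to
  generation \<open>q\<close>, so \<open>Z\<close> is measurable with respect to
  \<open>Fl q\<close>.\<close>

definition Z :: "real \<Rightarrow> nat \<Rightarrow> 'b \<Rightarrow> complex" where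
  "Z \<theta> q \<omega> = iexp (\<theta> * (\<Sum>p<q. D p \<omega>))"

lemma Z_measurable: "Z \<theta> q \<in> borel_measurable (Fl q)"
proof -
  have [measurable]: "D p \<in> borel_measurable (Fl q)" if "p < q" for p
    using measurable_Fl_mono[OF D_measurable_Fl] that by auto
  show ?thesis unfolding Z_def[abs_def] by measurable
qed

lemma Z_norm: "cmod (Z \<theta> q \<omega>) = 1"
  by (simp add: Z_def)

lemma Z_integrable: "integrable M (Z \<theta> q)"
  by (rule integrable_const_bound[where B=1]) (simp_all add: Z_norm measurable_Fl[OF Z_measurable])

lemma Z_Suc: "Z \<theta> (Suc q) \<omega> = Z \<theta> q \<omega> * (\<Prod>n\<in>generation q. iexp (\<theta> * g (X n \<omega>, Y n \<omega>)))"
proof -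
  have "(\<Prod>n\<in>generation q. iexp (\<theta> * g (X n \<omega>, Y n \<omega>))) = iexp (\<theta> * D q \<omega>)"
    unfolding D_def by (subst exp_sum[symmetric]) (simp_all add: sum_distrib_left)
  then show ?thesis by (simp add: Z_def distrib_left exp_add)
qed

text \<open>The first summand bounds the expansion error of the \<open>2 ^ q\<close> factors of a
  generation, the second the error of the law of large numbers for the conditional
  variances.\<close>

definition err :: "real \<Rightarrow> nat \<Rightarrow> real" where
  "err \<theta> q = (\<bar>\<theta>\<bar> ^ 3 + \<theta> ^ 4) * (2 ^ q * expectation (gen_avg q w)) +
     \<theta>\<^sup>2 / 2 * (2 ^ q * expectation (\<lambda>\<omega>. \<bar>gen_avg q v \<omega> - s2\<bar>))"

text \<open>Given \<open>Fl q\<close>, the characteristic function of \<open>D q\<close> is \<open>\<Prod>n\<in>generation q. cf \<theta> (X n)\<close>. It is compared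
  first with \<open>exp (- \<theta>\<^sup>2 / 2 * (\<Sum>n\<in>generation q. v (X n)))\<close>, then with its deterministic limit.\<close>

lemma generation_step:
  "cmod (expectation (Z \<theta> (Suc q)) - exp (- (\<theta>\<^sup>2 * 2 ^ q * s2 / 2)) * expectation (Z \<theta> q)) \<le> err \<theta> q"
proof -
  define U where "U \<omega> = (\<Prod>n\<in>generation q. cf \<theta> (X n \<omega>))" for \<omega>
  define c where "c = complex_of_real (exp (- (\<theta>\<^sup>2 * 2 ^ q * s2 / 2)))"
  define h where "h t = iexp (\<theta> * g t)" for t
  have hm: "h \<in> borel_measurable (borel \<Otimes>\<^sub>M (borel \<Otimes>\<^sub>M borel))"
    unfolding h_def[abs_def] by measurable
  have h1: "cmod (h t) \<le> 1" for t by (simp add: h_def)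
  note ip = integral_prod_offspring_complex[where h="\<lambda>_. h", OF Z_measurable[of \<theta> q] eq_refl[OF Z_norm] hm h1]
  have U_eq: "U \<omega> = (\<Prod>n\<in>generation q. \<integral>p. h (X n \<omega>, p) \<partial>P (X n \<omega>))" for \<omega>
    by (simp only: U_def cf_def h_def)
  have iZU: "integrable M (\<lambda>\<omega>. Z \<theta> q \<omega> * U \<omega>)"
    unfolding U_eq by (rule ip(1))
  have "expectation (Z \<theta> (Suc q)) = expectation (\<lambda>\<omega>. Z \<theta> q \<omega> * (\<Prod>n\<in>generation q. h (X n \<omega>, Y n \<omega>)))"
    by (intro Bochner_Integration.integral_cong refl) (simp only: Z_Suc h_def)
  also have "\<dots> = expectation (\<lambda>\<omega>. Z \<theta> q \<omega> * U \<omega>)"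
    unfolding U_eq by (rule ip(2))
  finally have eZU: "expectation (Z \<theta> (Suc q)) = expectation (\<lambda>\<omega>. Z \<theta> q \<omega> * U \<omega>)" .
  let ?B = "\<lambda>\<omega>. (\<bar>\<theta>\<bar> ^ 3 + \<theta> ^ 4) * (2 ^ q * gen_avg q w \<omega>) + \<theta>\<^sup>2 / 2 * (2 ^ q * \<bar>gen_avg q v \<omega> - s2\<bar>)"
  have bound: "cmod (Z \<theta> q \<omega> * U \<omega> - c * Z \<theta> q \<omega>) \<le> ?B \<omega>" for \<omega>
  proof -
    define V where "V = 2 ^ q * gen_avg q v \<omega>"
    define G where "G = (\<Prod>n\<in>generation q. complex_of_real (exp (- (\<theta>\<^sup>2 * v (X n \<omega>) / 2))))"
    have V: "V = (\<Sum>n\<in>generation q. v (X n \<omega>))" by (simp add: V_def gen_avg_def)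
    have V0: "0 \<le> V" unfolding V by (intro sum_nonneg v_nonneg)
    \<comment> \<open>For factors in the unit disc, the difference of two products is at most the
      sum of the differences of the factors.\<close>
    have "cmod (U \<omega> - G) \<le> (\<Sum>n\<in>generation q. cmod (cf \<theta> (X n \<omega>) - complex_of_real (exp (- (\<theta>\<^sup>2 * v (X n \<omega>) / 2)))))"
      unfolding U_def G_def
    proof (rule norm_prod_diff)
      show "cmod (complex_of_real (exp (- (\<theta>\<^sup>2 * v (X n \<omega>) / 2)))) \<le> 1" for n
        using v_nonneg[of "X n \<omega>"] by simp
    qed (rule cf_norm_le_1)
    also have "\<dots> \<le> (\<Sum>n\<in>generation q. (\<bar>\<theta>\<bar> ^ 3 + \<theta> ^ 4) * w (X n \<omega>))"
      by (intro sum_mono cf_approx)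
    also have "\<dots> = (\<bar>\<theta>\<bar> ^ 3 + \<theta> ^ 4) * (2 ^ q * gen_avg q w \<omega>)"
      by (simp add: gen_avg_def flip: sum_distrib_left)
    finally have UG: "cmod (U \<omega> - G) \<le> (\<bar>\<theta>\<bar> ^ 3 + \<theta> ^ 4) * (2 ^ q * gen_avg q w \<omega>)" .
    have "(\<Prod>n\<in>generation q. exp (- (\<theta>\<^sup>2 * v (X n \<omega>) / 2))) = exp (\<Sum>n\<in>generation q. - (\<theta>\<^sup>2 * v (X n \<omega>) / 2))"
      by (rule exp_sum[symmetric]) simp
    also have "(\<Sum>n\<in>generation q. - (\<theta>\<^sup>2 * v (X n \<omega>) / 2)) = - (\<theta>\<^sup>2 / 2 * V)"
      unfolding V by (simp add: sum_negf sum_distrib_left)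
    finally have G: "G = complex_of_real (exp (- (\<theta>\<^sup>2 / 2 * V)))"
      unfolding G_def by (simp only: flip: of_real_prod)
    have "cmod (G - c) = \<bar>exp (- (\<theta>\<^sup>2 / 2 * V)) - exp (- (\<theta>\<^sup>2 * 2 ^ q * s2 / 2))\<bar>"
      unfolding G c_def of_real_diff[symmetric] norm_of_real ..
    also have "\<dots> \<le> \<bar>\<theta>\<^sup>2 / 2 * V - \<theta>\<^sup>2 * 2 ^ q * s2 / 2\<bar>"
      using V0 s2_nonneg by (intro exp_minus_lipschitz) simp_all
    also have "\<theta>\<^sup>2 / 2 * V - \<theta>\<^sup>2 * 2 ^ q * s2 / 2 = \<theta>\<^sup>2 / 2 * (2 ^ q * (gen_avg q v \<omega> - s2))"
      unfolding V_def by (simp add: algebra_simps)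
    also have "\<bar>\<dots>\<bar> = \<theta>\<^sup>2 / 2 * (2 ^ q * \<bar>gen_avg q v \<omega> - s2\<bar>)"
      by (simp add: abs_mult)
    finally have Gc: "cmod (G - c) \<le> \<theta>\<^sup>2 / 2 * (2 ^ q * \<bar>gen_avg q v \<omega> - s2\<bar>)" .
    \<comment> \<open>The past enters through a common factor of modulus 1 and drops out of the
      estimate.\<close>
    have "Z \<theta> q \<omega> * U \<omega> - c * Z \<theta> q \<omega> = Z \<theta> q \<omega> * (U \<omega> - c)"
      by (simp only: right_diff_distrib mult.commute[of c])
    then have "cmod (Z \<theta> q \<omega> * U \<omega> - c * Z \<theta> q \<omega>) = cmod (U \<omega> - c)" by (simp only: norm_mult Z_norm mult_1)
    also have "U \<omega> - c = (U \<omega> - G) + (G - c)" by simp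
    also have "cmod \<dots> \<le> ?B \<omega>" by (rule norm_triangle_mono[OF UG Gc])
    finally show ?thesis .
  qed
  have iw: "integrable M (gen_avg q w)" and iv: "integrable M (\<lambda>\<omega>. \<bar>gen_avg q v \<omega> - s2\<bar>)"
    using integrable_gen_avg[OF w_F] integrable_gen_avg[OF v_F] by auto
  have iZc: "integrable M (\<lambda>\<omega>. c * Z \<theta> q \<omega>)" by (rule integrable_mult_right[OF Z_integrable])
  have iB1: "integrable M (\<lambda>\<omega>. (\<bar>\<theta>\<bar> ^ 3 + \<theta> ^ 4) * (2 ^ q * gen_avg q w \<omega>))"
    and iB2: "integrable M (\<lambda>\<omega>. \<theta>\<^sup>2 / 2 * (2 ^ q * \<bar>gen_avg q v \<omega> - s2\<bar>))"
    by (intro integrable_mult_right iw iv)+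
  have "cmod (expectation (\<lambda>\<omega>. Z \<theta> q \<omega> * U \<omega> - c * Z \<theta> q \<omega>)) \<le> expectation ?B"
  proof (rule norm_integral_le)
    show "integrable M (\<lambda>\<omega>. Z \<theta> q \<omega> * U \<omega> - c * Z \<theta> q \<omega>)"
      by (rule Bochner_Integration.integrable_diff[OF iZU iZc])
    show "integrable M ?B"
      by (rule Bochner_Integration.integrable_add[OF iB1 iB2])
  qed (rule bound)
  also have "expectation (\<lambda>\<omega>. Z \<theta> q \<omega> * U \<omega> - c * Z \<theta> q \<omega>) =
      expectation (Z \<theta> (Suc q)) - c * expectation (Z \<theta> q)"
    unfolding eZU Bochner_Integration.integral_diff[OF iZU iZc] integral_mult_right_zero ..
  also have "expectation ?B = err \<theta> q"
    unfolding err_def Bochner_Integration.integral_add[OF iB1 iB2] integral_mult_right_zero ..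
  finally show ?thesis unfolding c_def .
qed

text \<open>The Gaussian factor of each new generation has modulus at most 1, so errors made earlier
  are not amplified and simply add up.\<close>

lemma telescoping:
  "cmod (expectation (Z \<theta> r) - exp (- (\<theta>\<^sup>2 * (\<Sum>q<r. 2 ^ q) * s2 / 2))) \<le> (\<Sum>q<r. err \<theta> q)"
proof (induction r)
  case 0
  then show ?case by (simp add: Z_def prob_space)
next
  case (Suc r)
  define e where "e r = complex_of_real (exp (- (\<theta>\<^sup>2 * (\<Sum>q<r. 2 ^ q) * s2 / 2)))" for r
  define c where "c = complex_of_real (exp (- (\<theta>\<^sup>2 * 2 ^ r * s2 / 2)))"
  have "- (\<theta>\<^sup>2 * (\<Sum>q<Suc r. 2 ^ q) * s2 / 2) = - (\<theta>\<^sup>2 * 2 ^ r * s2 / 2) + - (\<theta>\<^sup>2 * (\<Sum>q<r. 2 ^ q) * s2 / 2)"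
    unfolding sum.lessThan_Suc by (simp only: distrib_left distrib_right add_divide_distrib minus_add_distrib)
  then have e: "e (Suc r) = c * e r"
    unfolding e_def c_def by (simp only: exp_add of_real_mult)
  have c1: "cmod c \<le> 1" unfolding c_def using s2_nonneg by simp
  have "cmod (c * (expectation (Z \<theta> r) - e r)) \<le> 1 * (\<Sum>q<r. err \<theta> q)"
    unfolding norm_mult by (rule mult_mono[OF c1 Suc[folded e_def]]) simp_all
  then have "cmod (c * (expectation (Z \<theta> r) - e r)) \<le> (\<Sum>q<r. err \<theta> q)" by simp
  from norm_triangle_mono[OF generation_step[of \<theta> r, folded c_def] this]
  have "cmod (expectation (Z \<theta> (Suc r)) - e (Suc r)) \<le> err \<theta> r + (\<Sum>q<r. err \<theta> q)"
    unfolding e by (simp add: right_diff_distrib)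
  then show ?case unfolding e_def sum.lessThan_Suc by (simp only: add.commute)
qed

section \<open>Convergence of the normalised statistic\<close>

definition stat :: "nat \<Rightarrow> 'b \<Rightarrow> real" where
  "stat r \<omega> = sqrt (real (card (tree_upto r))) * (tree_avg_triangle X r f \<omega> - tree_avg X r (P3 P f) \<omega>)"

lemma stat_eq: "stat r \<omega> = (\<Sum>q<Suc r. D q \<omega>) / sqrt (real (card (tree_upto r)))"
proof -
  define n where "n = real (card (tree_upto r))"
  have n: "0 < n" unfolding n_def by (rule card_tree_upto_pos)
  have "(\<Sum>i\<in>tree_upto r. f (X i \<omega>, X (2 * i) \<omega>, X (2 * i + 1) \<omega>)) - (\<Sum>i\<in>tree_upto r. P3 P f (X i \<omega>)) =
      (\<Sum>i\<in>tree_upto r. g (X i \<omega>, Y i \<omega>))"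
    by (simp add: g_def Y_def flip: sum_subtractf)
  also have "\<dots> = (\<Sum>q<Suc r. D q \<omega>)"
    unfolding sum_tree_upto D_def lessThan_Suc_atMost ..
  finally have "stat r \<omega> = sqrt n * ((\<Sum>q<Suc r. D q \<omega>) / n)"
    by (simp add: stat_def tree_avg_triangle_def tree_avg_def n_def diff_divide_distrib[symmetric])
  also have "\<dots> = (\<Sum>q<Suc r. D q \<omega>) / sqrt n"
    using sqrt_divide_self_eq[of n] n by (simp add: divide_inverse mult_ac)
  finally show ?thesis by (simp add: n_def)
qed

lemma stat_measurable [measurable]: "stat r \<in> borel_measurable M"
  unfolding stat_eq[abs_def]
  by (intro borel_measurable_divide borel_measurable_sum measurable_Fl[OF D_measurable_Fl]) auto

lemma char_stat:
  "char (distr M borel (stat r)) t = expectation (Z (t / sqrt (real (card (tree_upto r)))) (Suc r))"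
proof -
  have "char (distr M borel (stat r)) t = expectation (\<lambda>\<omega>. iexp (t * stat r \<omega>))"
    unfolding char_def by (rule integral_distr) measurable
  then show ?thesis by (simp add: stat_eq Z_def[abs_def])
qed

text \<open>At \<theta> = t / sqrt n, where n is the number of vertices and also the sum of the
  weights \<open>2 ^ q\<close>, the expansion errors are O(n^(-1/2)) in total, and the law of large
  numbers errors form a weighted average of a null sequence.\<close>

lemma err_sum_tendsto_0:
  "(\<lambda>r. \<Sum>q<Suc r. err (t / sqrt (real (card (tree_upto r)))) q) \<longlonglongrightarrow> 0"
proof -
  let ?n = "\<lambda>r. real (card (tree_upto r))"
  define e where "e q = expectation (\<lambda>\<omega>. \<bar>gen_avg q v \<omega> - s2\<bar>)" for q
  have e: "e \<longlonglongrightarrow> 0" unfolding e_def s2_def by (rule gen_avg_L1_tendsto[OF v_F])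
  have e0: "0 \<le> e q" for q unfolding e_def by (intro Bochner_Integration.integral_nonneg) simp
  obtain C where C: "\<And>q. expectation (gen_avg q w) \<le> C"
    using expectation_gen_avg_bounded[OF w_F] by blast
  have w0: "0 \<le> w x" for x unfolding w_def by (simp add: v_nonneg k_nonneg)
  have m0: "0 \<le> expectation (gen_avg q w)" for q
    by (intro Bochner_Integration.integral_nonneg) (simp add: gen_avg_def sum_nonneg w0)
  note n0 = card_tree_upto_pos
  let ?b = "\<lambda>r. (\<bar>t\<bar> ^ 3 / sqrt (?n r) + t ^ 4 / ?n r) * C + t\<^sup>2 / 2 * ((\<Sum>q\<le>r. 2 ^ q * e q) / (\<Sum>q\<le>r. 2 ^ q))"
  have bound: "(\<Sum>q<Suc r. err (t / sqrt (?n r)) q) \<le> ?b r" for r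
  proof -
    let ?\<theta> = "t / sqrt (?n r)"
    have "(\<Sum>q<Suc r. err ?\<theta> q) \<le> (\<Sum>q\<le>r. (\<bar>?\<theta>\<bar> ^ 3 + ?\<theta> ^ 4) * (2 ^ q * C) + ?\<theta>\<^sup>2 / 2 * (2 ^ q * e q))"
      unfolding lessThan_Suc_atMost err_def e_def[symmetric]
      by (intro sum_mono add_right_mono mult_left_mono C) auto
    also have "\<dots> = (\<bar>?\<theta>\<bar> ^ 3 + ?\<theta> ^ 4) * (?n r * C) + ?\<theta>\<^sup>2 / 2 * (\<Sum>q\<le>r. 2 ^ q * e q)"
      unfolding real_card_tree_upto sum.distrib sum_distrib_left sum_distrib_right ..
    \<comment> \<open>With s = sqrt n, the factor n = s^2 cancels two of the powers of s in each
      denominator.\<close>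
    also have "\<dots> = (\<bar>t\<bar> ^ 3 / sqrt (?n r) + t ^ 4 / ?n r) * C + t\<^sup>2 / 2 * ((\<Sum>q\<le>r. 2 ^ q * e q) / ?n r)"
    proof -
      define s where "s = sqrt (?n r)"
      have s: "0 < s" "?n r = s * s" using n0[of r] by (simp_all add: s_def)
      have "\<bar>t / s\<bar> ^ 3 * (s * s) = \<bar>t\<bar> ^ 3 / s" "(t / s) ^ 4 * (s * s) = t ^ 4 / (s * s)"
        using s(1) by (simp_all add: power_divide abs_divide field_simps eval_nat_numeral)
      moreover have "(t / s)\<^sup>2 / 2 * x = t\<^sup>2 / 2 * (x / (s * s))" for x
        by (simp add: power_divide power2_eq_square)
      moreover have "(x + y) * (z * C) = (x * z + y * z) * C" for x y z :: real
        by (simp add: algebra_simps)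
      ultimately show ?thesis unfolding s_def[symmetric] unfolding s(2) by (simp only:)
    qed
    finally show ?thesis by (simp only: real_card_tree_upto)
  qed
  have sq: "filterlim (\<lambda>r. sqrt (?n r)) at_top sequentially"
    by (rule filterlim_compose[OF sqrt_at_top filterlim_card_tree_upto])
  have "?b \<longlonglongrightarrow> (0 + 0) * C + t\<^sup>2 / 2 * 0"
    by (intro tendsto_add tendsto_mult tendsto_const weighted_average_tendsto_0[OF e]
        tendsto_divide_0[OF tendsto_const] filterlim_at_top_imp_at_infinity sq filterlim_card_tree_upto)
  then have b0: "?b \<longlonglongrightarrow> 0" by simp
  show ?thesis
  proof (rule tendsto_sandwich[OF _ _ tendsto_const b0])
    show "\<forall>\<^sub>F r in sequentially. 0 \<le> (\<Sum>q<Suc r. err (t / sqrt (?n r)) q)"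
      unfolding err_def e_def[symmetric]
      by (intro always_eventually allI sum_nonneg add_nonneg_nonneg mult_nonneg_nonneg m0 e0) auto
    show "\<forall>\<^sub>F r in sequentially. (\<Sum>q<Suc r. err (t / sqrt (?n r)) q) \<le> ?b r"
      using bound by simp
  qed
qed

lemma char_stat_tendsto:
  "(\<lambda>r. char (distr M borel (stat r)) t) \<longlonglongrightarrow> char (normal_law 0 s2) t"
proof -
  let ?n = "\<lambda>r. real (card (tree_upto r))"
  have "cmod (char (distr M borel (stat r)) t - char (normal_law 0 s2) t) \<le> (\<Sum>q<Suc r. err (t / sqrt (?n r)) q)" for r
  proof -
    note n0 = card_tree_upto_pos[of r]
    \<comment> \<open>The normalisation makes the Gaussian term of \<open>telescoping\<close> equal
      to the limit characteristic function for every \<open>r\<close>, so that only the errors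
      remain.\<close>
    have "(t / sqrt (?n r))\<^sup>2 * (\<Sum>q<Suc r. 2 ^ q) = t\<^sup>2"
      using n0 unfolding lessThan_Suc_atMost real_card_tree_upto[symmetric] by (simp add: power_divide)
    then show ?thesis
      using telescoping[of "t / sqrt (?n r)" "Suc r"] by (simp only: char_stat char_normal_law[OF s2_nonneg] minus_divide_left)
  qed
  then have "(\<lambda>r. cmod (char (distr M borel (stat r)) t - char (normal_law 0 s2) t)) \<longlonglongrightarrow> 0"
    by (intro tendsto_sandwich[OF _ _ tendsto_const err_sum_tendsto_0[of t]] always_eventually allI norm_ge_zero)
  then show ?thesis
    by (rule LIM_zero_cancel[OF tendsto_norm_zero_cancel])
qed

lemma stat_weak_conv: "weak_conv_m (\<lambda>r. distr M borel (stat r)) (normal_law 0 s2)"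
  by (intro levy_continuity real_distribution_distr real_distribution_normal_law s2_nonneg
      char_stat_tendsto stat_measurable)

end

theorem corollary21:
  fixes M :: "'b measure"
    and Fl :: "nat \<Rightarrow> 'b measure"
    and X :: "nat \<Rightarrow> 'b \<Rightarrow> 'a::metric_space"
    and P :: "'a \<Rightarrow> ('a \<times> 'a) measure"
    and \<nu> \<mu> :: "'a measure"
    and F :: "('a \<Rightarrow> real) set"
    and f :: "'a \<times> 'a \<times> 'a \<Rightarrow> real"
  assumes "bifurcating_markov_chain M Fl X \<nu> P"
    and "admissible_space P \<nu> \<mu> F"
    and "f \<in> borel_measurable (borel \<Otimes>\<^sub>M (borel \<Otimes>\<^sub>M borel))"
    and "P3_exists P f" and "P3 P f \<in> F"
    and "P3_exists P (\<lambda>t. (f t) ^ 2)" and "P3 P (\<lambda>t. (f t) ^ 2) \<in> F"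
    and "P3_exists P (\<lambda>t. (f t) ^ 4)" and "P3 P (\<lambda>t. (f t) ^ 4) \<in> F"
  shows "weak_conv_m
    (\<lambda>r. distr M borel (\<lambda>\<omega>. sqrt (real (card (tree_upto r))) *
       (tree_avg_triangle X r f \<omega> - tree_avg X r (P3 P f) \<omega>)))
    (normal_law 0 ((\<integral>x. P3 P (\<lambda>t. (f t) ^ 2) x \<partial>\<mu>) - (\<integral>x. (P3 P f x) ^ 2 \<partial>\<mu>)))"
proof -
  interpret bmc_functional P \<nu> \<mu> F M Fl X f
    by unfold_locales (use assms in \<open>simp_all add: bifurcating_markov_chain_def\<close>)
  show ?thesis
    using stat_weak_conv unfolding stat_def[abs_def] s2_eq .
qed

end
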